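(* Let $C$ be a smooth oriented regular curve in the Euclidean model $\mathbb{E}^3_0$ (equivalently, in $\mathbb{R}^3$), and let $\gamma$ be the curve in $\mathcal{S}(1,3)\cong\Theta(1,3)\subset\mathbb{R}^{10}_4$ which consists of the osculating circles of $C$, i.e. $\gamma(t)$ is the point corresponding to the osculating circle of $C$ at its point of parameter $t$. Then $\gamma$ is a lightlike curve.
   Context: $\mathbb{R}^5_1$ is $\mathbb{R}^5$ with coordinates $x_0,\dots,x_4$ and indefinite inner product $\langle \mathbf{x},\mathbf{y}\rangle=-x_0y_0+x_1y_1+\cdots+x_4y_4$. The light cone is $\{\mathbf{v}:\langle \mathbf{v},\mathbf{v}\rangle=0\}$. $\mathbb{R}^3$ is identified isometrically with $\mathbb{E}^3_0=\{(1+\frac{x\cdot x}{4},\,-1+\frac{x\cdot x}{4},\,x): x\in\mathbb{R}^3\}$ in the light cone, and $\mathbf{S}^3$ is realized as the intersection of the light cone with $\{x_0=1\}$ (points of either model represent lightlike lines). A $3$-dimensional subspace of $\mathbb{R}^5_1$ is timelike if $\langle\,,\,\rangle$ restricted to it is non-degenerate and indefinite. $\mathcal{S}(1,3)$ is the set of oriented circles in $\mathbb{R}^3$ or $\mathbf{S}^3$ (lines in $\mathbb{R}^3$ count as circles). An oriented circle is the intersection of the model with a unique oriented timelike $3$-dimensional subspace $W$; the orientation of $W$ is such that three points of the circle taken in the cyclic order given by its orientation form a positive basis of $W$. $\bigwedge^3\mathbb{R}^5_1\cong\mathbb{R}^{10}$ carries the indefinite inner product $\langle \mathbf{x}_1\wedge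 \mathbf{x}_2\wedge \mathbf{x}_3,\mathbf{y}_1\wedge \mathbf{y}_2\wedge \mathbf{y}_3\rangle=-\det(\langle \mathbf{x}_i,\mathbf{y}_j\rangle)_{1\le i,j\le 3}$, which has index $4$; this space is denoted $\mathbb{R}^{10}_4$. $\mathcal{S}(1,3)$ is identified with a subset $\Theta(1,3)\subset\mathbb{R}^{10}_4$ by sending the circle given by $W$ to $\mathbf{x}_1\wedge \mathbf{x}_2\wedge \mathbf{x}_3/\|\mathbf{x}_1\wedge \mathbf{x}_2\wedge \mathbf{x}_3\|$, where $(\mathbf{x}_1,\mathbf{x}_2,\mathbf{x}_3)$ is a positive basis of $W$ and $\|\mathbf{v}\|=\sqrt{|\langle \mathbf{v},\mathbf{v}\rangle|}$. The osculating circle of $C$ at a point is the circle with second order contact with $C$ there, oriented like $C$ at that point. A curve $\gamma$ in a pseudo-Euclidean space is lightlike if $\langle\dot\gamma,\dot\gamma\rangle\equiv0$ (vanishing velocity is allowed). *)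

theory Defs
  imports "HOL-Analysis.Analysis"
begin

section \<open>Iterated derivatives on an interval\<close>

definition nderiv :: "real set \<Rightarrow> nat \<Rightarrow> (real \<Rightarrow> 'a::real_normed_vector) \<Rightarrow> real \<Rightarrow> 'a" where
  "nderiv I k f = ((\<lambda>g t. vector_derivative g (at t within I)) ^^ k) f"

definition smooth_on :: "real set \<Rightarrow> (real \<Rightarrow> 'a::real_normed_vector) \<Rightarrow> bool" where
  "smooth_on I f \<longleftrightarrow> (\<forall>k. \<forall>t\<in>I. nderiv I k f differentiable (at t within I))"

definition regular_on :: "real set \<Rightarrow> (real \<Rightarrow> 'a::real_normed_vector) \<Rightarrow> bool" where
  "regular_on I f \<longleftrightarrow> (\<forall>t\<in>I. nderiv I 1 f t \<noteq> 0)"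


section \<open>Minkowski space and its subspaces\<close>

text \<open>The coordinates \<open>x\<^sub>0, \<dots>, x\<^sub>4\<close> are indexed by the numeral type 5 (in which 0 = 5).\<close>

definition mink :: "real^5 \<Rightarrow> real^5 \<Rightarrow> real" where
  "mink x y = - (x$0 * y$0) + x$1 * y$1 + x$2 * y$2 + x$3 * y$3 + x$4 * y$4"

definition embed_E3 :: "real^3 \<Rightarrow> real^5" where
  "embed_E3 x = (\<chi> i. if i = 0 then 1 + (x \<bullet> x) / 4
                     else if i = 1 then - 1 + (x \<bullet> x) / 4
                     else if i = 2 then x$1
                     else if i = 3 then x$2
                     else x$3)"

text \<open>In particular the image lies in the light cone, and the embedding is isometric.\<close>

lemma mink_embed_E3: "mink (embed_E3 x) (embed_E3 y) = - (dist x y)\<^sup>2 / 2"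
proof -
  have "(dist x y)\<^sup>2 = x \<bullet> x + y \<bullet> y - 2 * (x \<bullet> y)"
    by (simp add: dist_norm power2_norm_eq_inner inner_diff inner_commute)
  moreover have "mink (embed_E3 x) (embed_E3 y) =
      - ((1 + (x \<bullet> x) / 4) * (1 + (y \<bullet> y) / 4))
      + (- 1 + (x \<bullet> x) / 4) * (- 1 + (y \<bullet> y) / 4) + x \<bullet> y"
    by (simp add: mink_def embed_E3_def inner_vec_def sum_3)
  ultimately show ?thesis
    by (simp add: algebra_simps)
qed

lemma mink_embed_E3_diff:
  "mink (embed_E3 x - embed_E3 y) (embed_E3 x - embed_E3 y) = (dist x y)\<^sup>2"
proof -
  have "mink (a - b) (a - b) = mink a a + mink b b - 2 * mink a b" for a b
    by (simp add: mink_def algebra_simps)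
  then show ?thesis
    by (simp add: mink_embed_E3)
qed

definition timelike3 :: "(real^5) set \<Rightarrow> bool" where
  "timelike3 W \<longleftrightarrow> subspace W \<and> dim W = 3
     \<and> (\<forall>x\<in>W. (\<forall>y\<in>W. mink x y = 0) \<longrightarrow> x = 0)
     \<and> (\<exists>x\<in>W. mink x x < 0) \<and> (\<exists>x\<in>W. mink x x > 0)"

text \<open>An ordered triple \<open>(x\<^sub>1, x\<^sub>2, x\<^sub>3)\<close> of vectors is the matrix with these rows; left
  multiplication by a 3 by 3 matrix is then a change of basis. An orientation of a subspace is a
  class of ordered bases (the positive ones) under changes of basis with positive determinant.\<close>

definition ordered_basis :: "(real^5) set \<Rightarrow> real^5^3 \<Rightarrow> bool" where
  "ordered_basis W X \<longleftrightarrow> inj (\<lambda>i. X$i) \<and> independent (rows X) \<and> span (rows X) = W"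

definition orientation_class :: "real^5^3 \<Rightarrow> (real^5^3) set" where
  "orientation_class X = {A ** X | A :: real^3^3. det A > 0}"

definition oriented_timelike3 :: "(real^5) set \<Rightarrow> (real^5^3) set \<Rightarrow> bool" where
  "oriented_timelike3 W P \<longleftrightarrow>
     timelike3 W \<and> (\<exists>X. ordered_basis W X \<and> P = orientation_class X)"


section \<open>The third exterior power\<close>

text \<open>Coordinates with respect to the basis \<open>e\<^sub>i \<and> e\<^sub>j \<and> e\<^sub>k\<close>, \<open>i < j < k\<close>, in lexicographic
  order: the first six basis vectors contain \<open>e\<^sub>0\<close>, the last four do not.\<close>

definition minor3 :: "real^5^3 \<Rightarrow> 5 \<Rightarrow> 5 \<Rightarrow> 5 \<Rightarrow> real" where
  "minor3 X i j k = det (vector [column i X, column j X, column k X] :: real^3^3)"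

definition wedge :: "real^5^3 \<Rightarrow> real^10" where
  "wedge X = vector
     [minor3 X 0 1 2, minor3 X 0 1 3, minor3 X 0 1 4, minor3 X 0 2 3, minor3 X 0 2 4,
      minor3 X 0 3 4, minor3 X 1 2 3, minor3 X 1 2 4, minor3 X 1 3 4, minor3 X 2 3 4]"

definition ip10 :: "real^10 \<Rightarrow> real^10 \<Rightarrow> real" where
  "ip10 v w = v$1 * w$1 + v$2 * w$2 + v$3 * w$3 + v$4 * w$4 + v$5 * w$5 + v$6 * w$6
            - v$7 * w$7 - v$8 * w$8 - v$9 * w$9 - v$10 * w$10"

definition norm10 :: "real^10 \<Rightarrow> real" where
  "norm10 v = sqrt \<bar>ip10 v v\<bar>"

lemma vector_10:
  fixes a b c d e f g h i j :: "'a::zero"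
  defines "v \<equiv> vector [a,b,c,d,e,f,g,h,i,j] :: 'a^10"
  shows "v$1 = a" "v$2 = b" "v$3 = c" "v$4 = d" "v$5 = e"
    "v$6 = f" "v$7 = g" "v$8 = h" "v$9 = i" "v$10 = j"
  unfolding v_def vector_def by simp_all

text \<open>The inner product is the one induced by the Minkowski product.\<close>

lemma ip10_wedge:
  "ip10 (wedge X) (wedge Y) = - det (\<chi> i j. mink (X$i) (Y$j))"
proof -
  define D where "D k l m = minor3 Y k l m" for k l m
  have mX: "minor3 X i j k =
      X$1$i * X$2$j * X$3$k + X$2$i * X$3$j * X$1$k + X$3$i * X$1$j * X$2$k
    - X$1$i * X$3$j * X$2$k - X$2$i * X$1$j * X$3$k - X$3$i * X$2$j * X$1$k" for i j k
    by (simp add: minor3_def det_3 column_def)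
  have D: "D k l m = column k Y \<bullet> cross3 (column l Y) (column m Y)" for k l m
    by (simp add: D_def minor3_def det_3 cross3_def inner_vec_def sum_3 algebra_simps)
  have perm: "- D k l m = D l k m" "D k l m = D l m k" "D k l m = D m k l"
    "- D k l m = D k m l" "- D k l m = D m l k" for k l m
    by (simp_all add: D_def minor3_def det_3)
  have zero: "D k k l = 0" "D k l k = 0" "D l k k = 0" for k l
    by (simp_all add: D_def minor3_def det_3)
  define R where "R i = (- X$i$0) *\<^sub>R column 0 Y + X$i$1 *\<^sub>R column 1 Y + X$i$2 *\<^sub>R column 2 Y
      + X$i$3 *\<^sub>R column 3 Y + X$i$4 *\<^sub>R column 4 Y" for i
  have "mink (X$i) (Y$j) = R i $ j" for i j
    by (simp add: R_def mink_def column_def)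
  then have "det (\<chi> i j. mink (X$i) (Y$j)) = R 1 \<bullet> cross3 (R 2) (R 3)"
    by (simp add: det_3 cross3_def inner_vec_def sum_3 algebra_simps)
  also have "\<dots> = - ip10 (wedge X) (wedge Y)"
    unfolding ip10_def wedge_def vector_10 D_def[symmetric] mX
    by (simp add: R_def cross_add_left cross_add_right cross_mult_left cross_mult_right inner_add_left inner_add_right
        D[symmetric] zero scaleR_minus_left[symmetric]
    perm[of 0 1 2, symmetric] perm[of 0 1 3, symmetric] perm[of 0 1 4, symmetric] perm[of 0 2 3, symmetric] perm[of 0 2 4, symmetric]
    perm[of 0 3 4, symmetric] perm[of 1 2 3, symmetric] perm[of 1 2 4, symmetric] perm[of 1 3 4, symmetric] perm[of 2 3 4, symmetric]
        del: scaleR_minus_left) (simp add: algebra_simps)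
  finally show ?thesis by simp
qed


section \<open>Oriented circles\<close>

text \<open>An oriented circle is a pair of a point set and the cyclic order on it given by the
  orientation, i.e. the set of triples of distinct points met in this order.\<close>

type_synonym oriented_circle = "(real^3) set \<times> ((real^3) \<times> (real^3) \<times> (real^3)) set"

definition parametrizes_round :: "(real \<Rightarrow> real^3) \<Rightarrow> oriented_circle \<Rightarrow> bool" where
  "parametrizes_round f \<Gamma> \<longleftrightarrow>
     (\<exists>c r u v. r > 0 \<and> norm u = 1 \<and> norm v = 1 \<and> u \<bullet> v = 0
        \<and> f = (\<lambda>\<theta>. c + r *\<^sub>R (cos \<theta> *\<^sub>R u + sin \<theta> *\<^sub>R v)))
     \<and> \<Gamma> = (range f, {(f \<alpha>, f \<beta>, f \<gamma>) | \<alpha> \<beta> \<gamma>. \<alpha> < \<beta> \<and> \<beta> < \<gamma> \<and> \<gamma> < \<alpha> + 2 * pi})"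

definition parametrizes_line :: "(real \<Rightarrow> real^3) \<Rightarrow> oriented_circle \<Rightarrow> bool" where
  "parametrizes_line f \<Gamma> \<longleftrightarrow>
     (\<exists>p u. norm u = 1 \<and> f = (\<lambda>s. p + s *\<^sub>R u))
     \<and> \<Gamma> = (range f, {(f \<alpha>, f \<beta>, f \<gamma>) | \<alpha> \<beta> \<gamma>.
                       \<alpha> < \<beta> \<and> \<beta> < \<gamma> \<or> \<beta> < \<gamma> \<and> \<gamma> < \<alpha> \<or> \<gamma> < \<alpha> \<and> \<alpha> < \<beta>})"

definition parametrizes :: "(real \<Rightarrow> real^3) \<Rightarrow> oriented_circle \<Rightarrow> bool" where
  "parametrizes f \<Gamma> \<longleftrightarrow> parametrizes_round f \<Gamma> \<or> parametrizes_line f \<Gamma>"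

definition S13 :: "oriented_circle set" where
  "S13 = {\<Gamma>. \<exists>f. parametrizes f \<Gamma>}"

definition spans_circle :: "(real^5) set \<Rightarrow> (real^5^3) set \<Rightarrow> oriented_circle \<Rightarrow> bool" where
  "spans_circle W P \<Gamma> \<longleftrightarrow> oriented_timelike3 W P
     \<and> embed_E3 ` fst \<Gamma> = W \<inter> range embed_E3
     \<and> (\<forall>(p, q, r) \<in> snd \<Gamma>. vector [embed_E3 p, embed_E3 q, embed_E3 r] \<in> P)"

definition circle_point :: "oriented_circle \<Rightarrow> real^10" where
  "circle_point \<Gamma> =
     (THE v. \<exists>W P. spans_circle W P \<Gamma> \<and> (\<exists>X\<in>P. v = wedge X /\<^sub>R norm10 (wedge X)))"


section \<open>Osculating circles\<close>

text \<open>After a smooth orientation preserving change of parameter \<open>\<phi>\<close>, the curve \<open>g\<close> at \<open>b\<close> has the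
  same derivatives up to order two as \<open>f\<close> at \<open>a\<close>.\<close>

definition oriented_contact2 ::
    "real set \<Rightarrow> (real \<Rightarrow> 'a::real_normed_vector) \<Rightarrow> real \<Rightarrow> (real \<Rightarrow> 'a) \<Rightarrow> real \<Rightarrow> bool" where
  "oriented_contact2 I f a g b \<longleftrightarrow>
     (\<exists>\<phi>. smooth_on I \<phi> \<and> \<phi> a = b \<and> nderiv I 1 \<phi> a > 0
        \<and> (\<forall>k\<le>2. nderiv I k (g \<circ> \<phi>) a = nderiv I k f a))"

definition osculates :: "real set \<Rightarrow> (real \<Rightarrow> real^3) \<Rightarrow> real \<Rightarrow> oriented_circle \<Rightarrow> bool" where
  "osculates I C t \<Gamma> \<longleftrightarrow> (\<exists>g b. parametrizes g \<Gamma> \<and> oriented_contact2 I C t g b)"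

definition osculating_circle :: "real set \<Rightarrow> (real \<Rightarrow> real^3) \<Rightarrow> real \<Rightarrow> oriented_circle" where
  "osculating_circle I C t = (THE \<Gamma>. \<Gamma> \<in> S13 \<and> osculates I C t \<Gamma>)"


section \<open>Lightlike curves\<close>

definition lightlike_on ::
    "('a \<Rightarrow> 'a \<Rightarrow> real) \<Rightarrow> real set \<Rightarrow> (real \<Rightarrow> 'a::real_normed_vector) \<Rightarrow> bool" where
  "lightlike_on ip I \<gamma> \<longleftrightarrow>
     (\<forall>t\<in>I. \<gamma> differentiable (at t within I) \<and> ip (nderiv I 1 \<gamma> t) (nderiv I 1 \<gamma> t) = 0)"

end

theory Submission
  imports Defs
begin

text \<open>Lift the curve to a curve \<open>c\<close> in the light cone. The subspace of the osculating circle has the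
  positive basis \<open>c, c', c''\<close>, and its Gram determinant gives \<open>\<gamma> = c \<and> c' \<and> c'' / \<bar>C'\<bar>\<^sup>3\<close>. Hence both \<open>\<gamma>\<close>
  and \<open>\<gamma>'\<close> have the form \<open>c \<and> c' \<and> y\<close>. As \<open>c\<close> is null and orthogonal to \<open>c'\<close>, the square of such a
  trivector is \<open>(\<bar>C'\<bar> \<langle>c, y\<rangle>)\<^sup>2\<close>, a form of rank one; since \<open>\<langle>\<gamma>, \<gamma>\<rangle> = 1\<close> and so \<open>\<langle>\<gamma>, \<gamma>'\<rangle> = 0\<close>, it vanishes
  on \<open>\<gamma>'\<close>.\<close>

section \<open>Triples of vectors and their wedge products\<close>

text \<open>\<open>circle_point\<close> and \<open>osculating_circle\<close> are definite
  descriptions over point sets with cyclic orders, so any formula for \<gamma> first needs existence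
  and uniqueness in both. The bridge is \<open>circle_of X\<close>, read off from a triple
  \<open>X\<close> of vectors and depending only on its orientation class. A line or round circle is
  \<open>circle_of\<close> of its own 2-jet at each of its points, and second order contact
  multiplies the jet by a triangular matrix of positive determinant; so whatever osculates
  \<open>C\<close> at \<open>t\<close> is \<open>circle_of\<close> of the jet of \<open>C\<close>
  there, with no comparison of centres and radii. Cyclic orders become signs: the coordinates of
  three points with respect to the jet form a 3 by 3 matrix whose determinant factors
  explicitly.\<close>

lemma matrix_mult_row: "(A ** X) $ i = A $ i v* (X::real^'n^'m)"
  by (simp add: vec_eq_iff matrix_matrix_mult_def vector_matrix_mult_def mult.commute)

lemma vector_matrix_mult_3:
  "y v* X = y$1 *\<^sub>R X$1 + y$2 *\<^sub>R X$2 + y$3 *\<^sub>R (X::real^'n^3)$3"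
  by (simp add: vec_eq_iff vector_matrix_mult_def sum_3 mult.commute)

lemma vector_3_matrix_mult:
  "vector [a, b, c] ** (X::real^'n^3) = (vector [a v* X, b v* X, c v* X] :: real^'n^3)"
  by (subst vec_eq_iff) (simp add: forall_3 matrix_mult_row)

lemma rows_3: "rows (X::real^'n^3) = {X$1, X$2, X$3}"
  by (auto simp: rows_def row_def) (metis exhaust_3)

lemma span_rows_3: "span (rows (X::real^'n^3)) = range (\<lambda>y. y v* X)"
proof
  have "subspace (range (\<lambda>y. y v* X))"
    by (auto simp: subspace_def vector_matrix_mult_3 intro: range_eqI[of _ _ 0]
        range_eqI[of _ _ "_ + _"] range_eqI[of _ _ "_ *\<^sub>R _"] simp: algebra_simps)
  moreover have "rows X \<subseteq> range (\<lambda>y. y v* X)"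
  proof -
    have "X$1 = vector [1, 0, 0] v* X" "X$2 = vector [0, 1, 0] v* X" "X$3 = vector [0, 0, 1] v* X"
      by (simp_all add: vector_matrix_mult_3)
    then show ?thesis
      unfolding rows_3 by blast
  qed
  ultimately show "span (rows X) \<subseteq> range (\<lambda>y. y v* X)"
    by (simp add: span_minimal)
  have "X$1 \<in> span (rows X)" "X$2 \<in> span (rows X)" "X$3 \<in> span (rows X)"
    by (simp_all add: rows_3 span_base)
  then show "range (\<lambda>y. y v* X) \<subseteq> span (rows X)"
    by (auto simp: vector_matrix_mult_3 intro!: span_add span_scale)
qed

lemma minor3_matrix_mult: "minor3 (A ** X) i j k = det A * minor3 X i j k"
proof -
  have "vector [column i (A ** X), column j (A ** X), column k (A ** X)]
      = (vector [column i X, column j X, column k X] ** transpose A :: real^3^3)"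
    by (subst vec_eq_iff)
      (simp add: forall_3 vec_eq_iff column_def matrix_matrix_mult_def transpose_def sum_3 mult.commute)
  then show ?thesis
    by (simp add: minor3_def det_mul mult.commute)
qed

lemma vector_10_scaleR:
  "vector [r * a, r * b, r * c, r * d, r * e, r * f, r * g, r * h, r * i, r * j]
    = (r *\<^sub>R vector [a, b, c, d, e, f, g, h, i, j] :: real^10)"
  by (simp add: vec_eq_iff vector_def)

lemma wedge_matrix_mult: "wedge (A ** X) = det A *\<^sub>R wedge X"
  by (simp only: wedge_def minor3_matrix_mult vector_10_scaleR)

lemma ip10_scaleR: "ip10 (a *\<^sub>R v) (b *\<^sub>R w) = a * b * ip10 v w"
  by (simp add: ip10_def algebra_simps)

lemma norm10_scaleR: "norm10 (a *\<^sub>R v) = \<bar>a\<bar> * norm10 v"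
  by (simp add: norm10_def ip10_scaleR abs_mult real_sqrt_mult)

lemma normalize_scaleR:
  "a > 0 \<Longrightarrow> (a *\<^sub>R v) /\<^sub>R norm10 (a *\<^sub>R v) = v /\<^sub>R norm10 v"
  by (simp add: norm10_scaleR)

text \<open>Left multiplication scales the wedge by \<open>det A > 0\<close>, which normalization
  removes; hence the choice of positive basis in \<open>circle_point\<close> is harmless.\<close>

lemma orientation_class_wedge:
  assumes "Y \<in> orientation_class X"
  shows "wedge Y /\<^sub>R norm10 (wedge Y) = wedge X /\<^sub>R norm10 (wedge X)"
  using assms normalize_scaleR by (auto simp: orientation_class_def wedge_matrix_mult)

lemma orientation_class_refl: "X \<in> orientation_class X"
  unfolding orientation_class_def
  by (rule CollectI, rule exI[of _ "mat 1"]) simp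

lemma orientation_class_mono:
  assumes "Y \<in> orientation_class X"
  shows "orientation_class Y \<subseteq> orientation_class X"
proof
  fix Z assume "Z \<in> orientation_class Y"
  with assms obtain A B :: "real^3^3" where "det A > 0" "det B > 0" "Z = (A ** B) ** X"
    by (auto simp: orientation_class_def matrix_mul_assoc)
  then show "Z \<in> orientation_class X"
    by (force simp: orientation_class_def det_mul)
qed

lemma orientation_class_sym:
  assumes "Y \<in> orientation_class X"
  shows "X \<in> orientation_class Y"
proof -
  from assms obtain A :: "real^3^3" where A: "det A > 0" "Y = A ** X"
    by (auto simp: orientation_class_def)
  then obtain B where B: "B ** A = mat 1"
    by (metis invertible_def invertible_det_nz less_irrefl)
  with A have "X = B ** Y" "det B * det A = 1"
    by (simp_all add: matrix_mul_assoc det_mul[symmetric])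
  with A show ?thesis
    by (force simp: orientation_class_def zero_less_mult_iff
        intro: zero_less_mult_pos2[of "det B" "det A"])
qed

lemma orientation_class_eq:
  "Y \<in> orientation_class X \<Longrightarrow> orientation_class Y = orientation_class X"
  by (meson antisym orientation_class_mono orientation_class_sym)

lemma span_rows_orientation_class:
  assumes "Y \<in> orientation_class X"
  shows "span (rows Y) = span (rows X)"
proof -
  have le: "span (rows Y) \<subseteq> span (rows X)" if "Y \<in> orientation_class X" for X Y
  proof -
    from that obtain A :: "real^3^3" where "Y = A ** X"
      by (auto simp: orientation_class_def)
    then have "y v* Y = (y v* A) v* X" for y
      by (simp only: vector_matrix_mul_assoc)
    then show ?thesis
      unfolding span_rows_3 by blast
  qed
  show ?thesis
    using le[OF assms] le[OF orientation_class_sym[OF assms]] by (rule equalityI)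
qed

section \<open>Gram matrices and nondegenerate triples\<close>

lemma mink_add_scaleR:
  "mink (x + y) z = mink x z + mink y z" "mink (r *\<^sub>R x) z = r * mink x z"
  "mink z (x + y) = mink z x + mink z y" "mink z (r *\<^sub>R x) = r * mink z x"
  by (simp_all add: mink_def algebra_simps)

definition gram :: "real^5^3 \<Rightarrow> real^3^3" where
  "gram X = (\<chi> i j. mink (X$i) (X$j))"

lemma det_gram: "det (gram X) = - ip10 (wedge X) (wedge X)"
  by (simp add: gram_def ip10_wedge)

lemma sum_5: "sum f (UNIV :: 5 set) = f 0 + f 1 + f 2 + f 3 + f 4"
proof -
  have U: "UNIV = {0, 1, 2, 3, 4 :: 5}"
    by (rule card_seteq[symmetric]) simp_all
  show ?thesis
    unfolding U by (simp add: add.assoc)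
qed

text \<open>The second factor is the Minkowski metric applied to the transpose of \<open>X\<close>.
  Pulling out \<open>X\<close> turns an inverse of the Gram matrix into a right inverse of
  \<open>X\<close>.\<close>

lemma gram_factor: "gram X = X ** (\<chi> k j. if k = 0 then - (X$j$0) else X$j$k)"
  by (simp add: vec_eq_iff gram_def mink_def matrix_matrix_mult_def sum_5)

lemma nondegenerate_right_inverse:
  assumes "ip10 (wedge X) (wedge X) \<noteq> 0"
  obtains B where "X ** B = mat 1"
proof -
  from assms obtain G where "gram X ** G = mat 1"
    by (metis det_gram invertible_def invertible_det_nz neg_equal_0_iff_equal)
  then have "X ** ((\<chi> k j. if k = 0 then - (X$j$0) else X$j$k) ** G) = mat 1"
    by (simp only: gram_factor matrix_mul_assoc)
  then show ?thesis
    by (rule that)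
qed

lemma nondegenerate_cancel:
  assumes "ip10 (wedge X) (wedge X) \<noteq> 0" and "A ** X = A' ** X"
  shows "A = A'"
proof -
  obtain B where B: "X ** B = mat 1"
    using assms(1) nondegenerate_right_inverse by blast
  have "(A ** X) ** B = (A' ** X) ** B"
    by (simp only: assms(2))
  then show ?thesis
    by (simp only: matrix_mul_assoc[symmetric] B matrix_mul_rid)
qed

text \<open>A right inverse forces the three rows to span three dimensions, so they are distinct and
  independent.\<close>

lemma nondegenerate_ordered_basis:
  assumes "ip10 (wedge X) (wedge X) \<noteq> 0"
  shows "ordered_basis (span (rows X)) X" and "dim (span (rows X)) = 3"
proof -
  obtain B where B: "X ** B = mat 1"
    using assms nondegenerate_right_inverse by blast
  have 3: "3 \<le> dim (rows X)"
    using rank_mul_le_left[of X B] rank_I[where 'n=3] by (simp add: B row_rank_def)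
  have card: "card (rows X) \<le> 3"
    by (simp add: rows_3 card_insert_le_m1)
  have fin: "finite (rows X)"
    by (simp add: rows_3)
  have "dim (rows X) \<le> card (rows X)"
    by (simp add: dim_le_card' fin)
  with 3 card have eq: "card (rows X) = 3" "dim (rows X) = 3"
    by simp_all
  then show "dim (span (rows X)) = 3"
    by simp
  have "independent (rows X)"
    using eq fin by (metis card_eq_dim span_superset order_refl)
  moreover have "inj (\<lambda>i. X$i)"
  proof (rule eq_card_imp_inj_on)
    have "range (($) X) = rows X"
      by (auto simp: rows_def row_def)
    then show "card (range (($) X)) = card (UNIV::3 set)"
      using eq by simp
  qed simp
  ultimately show "ordered_basis (span (rows X)) X"
    by (simp add: ordered_basis_def)
qed

lemma nondegenerate_span_rows:
  assumes "ip10 (wedge X) (wedge X) \<noteq> 0" and "x \<in> span (rows X)"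
    and "\<And>y. y \<in> span (rows X) \<Longrightarrow> mink x y = 0"
  shows "x = 0"
proof -
  obtain y where y: "x = y v* X"
    using assms(2) by (auto simp: span_rows_3)
  have "X $ j \<in> span (rows X)" for j
    using exhaust_3[of j] by (auto simp: rows_3 intro: span_base)
  then have "mink x (X $ j) = 0" for j
    using assms(3) by blast
  then have "y v* gram X = 0"
    by (simp add: vec_eq_iff y vector_matrix_mult_3 mink_add_scaleR gram_def)
  moreover from assms(1) obtain G where "gram X ** G = mat 1"
    by (metis det_gram invertible_def invertible_det_nz neg_equal_0_iff_equal)
  ultimately have "y = 0"
    by (metis vector_matrix_mul_assoc vector_matrix_mul_rid vector_matrix_mult_0)
  then show ?thesis
    by (simp add: y)
qed

section \<open>The circle determined by a triple\<close>

text \<open>This is \<open>spans_circle\<close> solved for the circle, given a positive basis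
  \<open>X\<close>. It makes sense for every triple; that it contains points is supplied separately
  by a witness \<open>(p, q, r)\<close>.\<close>

definition circle_of :: "real^5^3 \<Rightarrow> oriented_circle" where
  "circle_of X = ({x. embed_E3 x \<in> span (rows X)},
     {(p, q, r). vector [embed_E3 p, embed_E3 q, embed_E3 r] \<in> orientation_class X})"

lemma circle_of_orientation_class:
  "Y \<in> orientation_class X \<Longrightarrow> circle_of Y = circle_of X"
  by (simp add: circle_of_def orientation_class_eq[of Y X] span_rows_orientation_class[of Y X])

text \<open>Two distinct points of the witness triple give indefiniteness: as their lifts are null,
  the sum and the difference have squares minus and plus \<open>(dist p q)\<^sup>2\<close>.\<close>

lemma timelike3_span_rows:
  assumes X: "ip10 (wedge X) (wedge X) \<noteq> 0" and pqr: "(p, q, r) \<in> snd (circle_of X)"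
  shows "timelike3 (span (rows X))"
proof -
  define Y :: "real^5^3" where "Y = vector [embed_E3 p, embed_E3 q, embed_E3 r]"
  have "Y \<in> orientation_class X"
    using pqr by (simp add: Y_def circle_of_def)
  then obtain A :: "real^3^3" where A: "det A > 0" "Y = A ** X" and
    span: "span (rows Y) = span (rows X)"
    using span_rows_orientation_class by (auto simp: orientation_class_def)
  with X have "ip10 (wedge Y) (wedge Y) \<noteq> 0"
    by (simp add: wedge_matrix_mult ip10_scaleR)
  then have "inj (($) Y)"
    using nondegenerate_ordered_basis by (simp add: ordered_basis_def)
  then have "Y $ 1 \<noteq> Y $ 2"
    by (simp add: inj_eq)
  then have pq: "dist p q > 0"
    by (auto simp: Y_def)
  have "embed_E3 p \<in> rows Y" "embed_E3 q \<in> rows Y"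
    by (simp_all add: rows_3 Y_def)
  then have *: "embed_E3 p + embed_E3 q \<in> span (rows X)" "embed_E3 p - embed_E3 q \<in> span (rows X)"
    unfolding span[symmetric] by (auto intro: span_add span_diff span_base)
  have "mink (embed_E3 p + embed_E3 q) (embed_E3 p + embed_E3 q) = - (dist p q)\<^sup>2"
    by (simp add: mink_add_scaleR mink_embed_E3 dist_commute)
  with pq have "mink (embed_E3 p + embed_E3 q) (embed_E3 p + embed_E3 q) < 0"
    by simp
  moreover have "mink (embed_E3 p - embed_E3 q) (embed_E3 p - embed_E3 q) > 0"
    using pq by (simp add: mink_embed_E3_diff)
  ultimately show ?thesis
    using * nondegenerate_ordered_basis(2)[OF X] nondegenerate_span_rows[OF X]
    by (auto simp: timelike3_def)
qed

lemma spans_circle_circle_of: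
  assumes X: "ip10 (wedge X) (wedge X) \<noteq> 0" and "(p, q, r) \<in> snd (circle_of X)"
  shows "spans_circle (span (rows X)) (orientation_class X) (circle_of X)"
  using timelike3_span_rows[OF assms] nondegenerate_ordered_basis(1)[OF X]
  by (auto simp: spans_circle_def oriented_timelike3_def circle_of_def)

text \<open>The witness pins down the orientation: its lifts lie both in any admissible
  \<open>P\<close> and in the class of \<open>X\<close>. With an empty cyclic order the positivity
  condition of \<open>spans_circle\<close> would be vacuous.\<close>

lemma circle_point_circle_of:
  assumes X: "ip10 (wedge X) (wedge X) \<noteq> 0" and pqr: "(p, q, r) \<in> snd (circle_of X)"
  shows "circle_point (circle_of X) = wedge X /\<^sub>R norm10 (wedge X)"
  unfolding circle_point_def
proof (rule the_equality)
  show "\<exists>W P. spans_circle W P (circle_of X)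
      \<and> (\<exists>Y\<in>P. wedge X /\<^sub>R norm10 (wedge X) = wedge Y /\<^sub>R norm10 (wedge Y))"
    using spans_circle_circle_of[OF assms] orientation_class_refl by blast
next
  fix v
  assume "\<exists>W P. spans_circle W P (circle_of X) \<and> (\<exists>Y\<in>P. v = wedge Y /\<^sub>R norm10 (wedge Y))"
  then obtain W P Y where P: "spans_circle W P (circle_of X)" "Y \<in> P"
    and v: "v = wedge Y /\<^sub>R norm10 (wedge Y)"
    by blast
  define T :: "real^5^3" where "T = vector [embed_E3 p, embed_E3 q, embed_E3 r]"
  from P obtain Z where Z: "P = orientation_class Z"
    by (auto simp: spans_circle_def oriented_timelike3_def)
  have "T \<in> P"
    using P(1) pqr by (auto simp: T_def spans_circle_def)
  moreover have "T \<in> orientation_class X"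
    using pqr by (simp add: T_def circle_of_def)
  ultimately show "v = wedge X /\<^sub>R norm10 (wedge X)"
    using P(2) v Z orientation_class_wedge by metis
qed

text \<open>\<open>k s\<close> lists the coordinates of the lifted point \<open>f s\<close> in the
  basis \<open>X\<close>, so three points are positively ordered exactly when their coordinate
  matrix has positive determinant. That matrix is unique because \<open>X\<close> can be
  cancelled.\<close>

lemma circle_eq_circle_of:
  assumes X: "ip10 (wedge X) (wedge X) \<noteq> 0"
    and f: "\<And>s. embed_E3 (f s) = k s v* X"
    and range: "\<And>x. embed_E3 x \<in> span (rows X) \<Longrightarrow> x \<in> range f"
    and T: "T = {(f \<alpha>, f \<beta>, f \<gamma>) | \<alpha> \<beta> \<gamma>. det (vector [k \<alpha>, k \<beta>, k \<gamma>] :: real^3^3) > 0}"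
  shows "(range f, T) = circle_of X"
proof -
  have tri: "vector [embed_E3 (f \<alpha>), embed_E3 (f \<beta>), embed_E3 (f \<gamma>)] = (vector [k \<alpha>, k \<beta>, k \<gamma>] :: real^3^3) ** X"
    for \<alpha> \<beta> \<gamma>
    by (simp add: f vector_3_matrix_mult)
  have iff: "(f \<alpha>, f \<beta>, f \<gamma>) \<in> snd (circle_of X)
      \<longleftrightarrow> det (vector [k \<alpha>, k \<beta>, k \<gamma>] :: real^3^3) > 0" for \<alpha> \<beta> \<gamma>
    by (auto simp: circle_of_def tri orientation_class_def dest: nondegenerate_cancel[OF X])
  have fst: "range f = fst (circle_of X)"
    using range by (auto simp: circle_of_def f span_rows_3)
  have "p \<in> range f \<and> q \<in> range f \<and> r \<in> range f" if "(p, q, r) \<in> snd (circle_of X)" for p q r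
  proof -
    from that have "span (rows (vector [embed_E3 p, embed_E3 q, embed_E3 r] :: real^5^3)) = span (rows X)"
      by (simp add: circle_of_def span_rows_orientation_class)
    then have "embed_E3 p \<in> span (rows X)" "embed_E3 q \<in> span (rows X)" "embed_E3 r \<in> span (rows X)"
      by (auto simp: rows_3 intro: span_base)
    with range show ?thesis
      by blast
  qed
  then have "snd (circle_of X) = {(f \<alpha>, f \<beta>, f \<gamma>) | \<alpha> \<beta> \<gamma>. (f \<alpha>, f \<beta>, f \<gamma>) \<in> snd (circle_of X)}"
    by fast
  with fst show ?thesis
    by (simp add: T iff[symmetric] prod_eq_iff)
qed

section \<open>Second order jets in Minkowski space\<close>

text \<open>\<open>a\<close> and \<open>b\<close> are null coordinates. They make the quadratic
  embedding a linear map evaluated at \<open>(1, x \<bullet> x, x)\<close>, so derivatives and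
  linear combinations can be taken before lifting.\<close>

definition lift :: "real \<times> real \<times> (real^3) \<Rightarrow> real^5" where
  "lift = (\<lambda>(a, b, x). \<chi> i. if i = 0 then a + b / 4
                     else if i = 1 then - a + b / 4
                     else if i = 2 then x$1
                     else if i = 3 then x$2
                     else x$3)"

lemma embed_E3_lift: "embed_E3 x = lift (1, x \<bullet> x, x)"
  by (simp only: embed_E3_def lift_def prod.case)

lemma linear_lift: "linear lift"
  by (rule linearI) (auto simp: lift_def vec_eq_iff field_simps)

lemma lift_add: "lift u + lift v = lift (u + v)"
  by (simp add: linear_add linear_lift)

lemma lift_scaleR: "r *\<^sub>R lift u = lift (r *\<^sub>R u)"
  by (simp add: linear_scale linear_lift)

lemma bounded_linear_lift: "bounded_linear lift"
  using linear_lift by (simp add: linear_conv_bounded_linear)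

lemma mink_lift: "mink (lift (a, b, x)) (lift (a', b', x')) = x \<bullet> x' - (a * b' + a' * b) / 2"
  by (simp add: mink_def lift_def inner_vec_def sum_3 field_simps)

lemma lift_eq_iff: "lift u = lift v \<longleftrightarrow> u = v"
proof
  assume eq: "lift u = lift v"
  obtain a b x where u: "u = (a, b, x)" by (cases u)
  obtain a' b' x' where v: "v = (a', b', x')" by (cases v)
  have "lift u $ 0 = lift v $ 0" "lift u $ 1 = lift v $ 1" "lift u $ 2 = lift v $ 2"
    "lift u $ 3 = lift v $ 3" "lift u $ 4 = lift v $ 4"
    using eq by simp_all
  then show "u = v"
    by (simp add: u v lift_def vec_eq_iff forall_3)
qed simp

text \<open>For a curve with value \<open>x\<close>, velocity \<open>v\<close> and acceleration \<open>a\<close> at a point, these are the value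
  and the first two derivatives there of its image under \<^const>\<open>embed_E3\<close>.\<close>

definition jet :: "real^3 \<Rightarrow> real^3 \<Rightarrow> real^3 \<Rightarrow> real^5^3" where
  "jet x v a = vector [lift (1, x \<bullet> x, x), lift (0, 2 * (x \<bullet> v), v), lift (0, 2 * (v \<bullet> v + x \<bullet> a), a)]"

lemma vector_matrix_mult_jet:
  "y v* jet x v a = lift (y$1, y$1 * (x \<bullet> x) + 2 * y$2 * (x \<bullet> v) + 2 * y$3 * (v \<bullet> v + x \<bullet> a),
     y$1 *\<^sub>R x + y$2 *\<^sub>R v + y$3 *\<^sub>R a)"
  by (simp add: vector_matrix_mult_3 jet_def lift_scaleR lift_add algebra_simps)

text \<open>With \<open>s = v \<bullet> v\<close> the Gram matrix vanishes above its antidiagonal,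
  whose entries are -s, s, -s. The acceleration enters only below it, so for nonzero
  \<open>v\<close> the triple is nondegenerate even where the curvature is zero.\<close>

lemma ip10_wedge_jet: "ip10 (wedge (jet x v a)) (wedge (jet x v a)) = (v \<bullet> v) ^ 3"
  by (simp add: ip10_wedge det_3 jet_def mink_lift inner_commute power3_eq_cube field_simps)

lemma norm10_wedge_jet: "norm10 (wedge (jet x v a)) = norm v ^ 3"
proof -
  have "(v \<bullet> v) ^ 3 = (norm v ^ 3)\<^sup>2"
    by (simp add: power2_norm_eq_inner[symmetric] power_mult[symmetric])
  then show ?thesis
    by (simp only: norm10_def ip10_wedge_jet abs_power2 real_sqrt_abs) simp
qed

text \<open>The chain rule for a change of parameter with first derivative \<open>r\<close> and
  second derivative \<open>q\<close>: its matrix is lower triangular with diagonal 1,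
  \<open>r\<close>, \<open>r\<^sup>2\<close>.\<close>

lemma jet_reparametrize:
  assumes "r > 0"
  shows "jet x (r *\<^sub>R v) (r\<^sup>2 *\<^sub>R a + q *\<^sub>R v) \<in> orientation_class (jet x v a)"
proof -
  define A :: "real^3^3" where "A = vector [vector [1, 0, 0], vector [0, r, 0], vector [0, q, r\<^sup>2]]"
  have "det A = r ^ 3"
    by (simp add: A_def det_3 power2_eq_square power3_eq_cube)
  moreover have "jet x (r *\<^sub>R v) (r\<^sup>2 *\<^sub>R a + q *\<^sub>R v) = A ** jet x v a"
    unfolding A_def vector_3_matrix_mult vector_matrix_mult_jet
    by (simp add: jet_def algebra_simps power2_eq_square)
  ultimately show ?thesis
    using assms by (auto simp: orientation_class_def)
qed

section \<open>Lines and round circles recovered from their jets\<close>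

lemma line_eq_circle_of:
  assumes u: "norm u = 1" and f: "f = (\<lambda>s. p + s *\<^sub>R u)"
  shows "(range f, {(f \<alpha>, f \<beta>, f \<gamma>) | \<alpha> \<beta> \<gamma>.
      \<alpha> < \<beta> \<and> \<beta> < \<gamma> \<or> \<beta> < \<gamma> \<and> \<gamma> < \<alpha> \<or> \<gamma> < \<alpha> \<and> \<alpha> < \<beta>}) = circle_of (jet (f b) u 0)"
proof (rule circle_eq_circle_of)
  have uu: "u \<bullet> u = 1"
    using u by (simp add: norm_eq_1)
  \<comment> \<open>The lift of a line is quadratic in the parameter, so its Taylor expansion at
    \<open>b\<close> stops here.\<close>
  define k :: "real \<Rightarrow> real^3" where "k s = vector [1, s - b, (s - b)\<^sup>2 / 2]" for s
  show "ip10 (wedge (jet (f b) u 0)) (wedge (jet (f b) u 0)) \<noteq> 0"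
    by (simp add: ip10_wedge_jet uu)
  have f_b: "f s = f b + (s - b) *\<^sub>R u" for s
    by (simp add: f algebra_simps)
  have ff: "f s \<bullet> f s = f b \<bullet> f b + 2 * (s - b) * (f b \<bullet> u) + (s - b)\<^sup>2" for s
    unfolding f_b[of s]
    by (simp add: inner_add uu power2_eq_square inner_commute algebra_simps)
  have "k s v* jet (f b) u 0
      = lift (1, f b \<bullet> f b + 2 * (s - b) * (f b \<bullet> u) + (s - b)\<^sup>2, f b + (s - b) *\<^sub>R u)" for s
    by (simp add: vector_matrix_mult_jet k_def uu)
  then show "embed_E3 (f s) = k s v* jet (f b) u 0" for s
    by (simp only: embed_E3_lift ff[of s] f_b[of s, symmetric])
  show "x \<in> range f" if "embed_E3 x \<in> span (rows (jet (f b) u 0))" for x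
  proof -
    from that obtain y where "embed_E3 x = y v* jet (f b) u 0"
      by (auto simp: span_rows_3)
    then have "x = f b + y$2 *\<^sub>R u"
      by (auto simp: embed_E3_lift vector_matrix_mult_jet lift_eq_iff)
    then have "x = f (b + y$2)"
      by (simp add: f algebra_simps)
    then show ?thesis
      by blast
  qed
  \<comment> \<open>A Vandermonde determinant, positive exactly for the cyclic order of the
    parameters.\<close>
  have det: "det (vector [k \<alpha>, k \<beta>, k \<gamma>] :: real^3^3) = (\<beta> - \<alpha>) * (\<gamma> - \<alpha>) * (\<gamma> - \<beta>) / 2" for \<alpha> \<beta> \<gamma>
    by (simp add: k_def det_3 power2_eq_square field_simps)
  have "\<alpha> < \<beta> \<and> \<beta> < \<gamma> \<or> \<beta> < \<gamma> \<and> \<gamma> < \<alpha> \<or> \<gamma> < \<alpha> \<and> \<alpha> < \<beta>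
      \<longleftrightarrow> det (vector [k \<alpha>, k \<beta>, k \<gamma>] :: real^3^3) > 0" for \<alpha> \<beta> \<gamma>
    unfolding det by (auto simp: zero_less_mult_iff mult_less_0_iff)
  then show "{(f \<alpha>, f \<beta>, f \<gamma>) | \<alpha> \<beta> \<gamma>.
      \<alpha> < \<beta> \<and> \<beta> < \<gamma> \<or> \<beta> < \<gamma> \<and> \<gamma> < \<alpha> \<or> \<gamma> < \<alpha> \<and> \<alpha> < \<beta>}
    = {(f \<alpha>, f \<beta>, f \<gamma>) | \<alpha> \<beta> \<gamma>. det (vector [k \<alpha>, k \<beta>, k \<gamma>] :: real^3^3) > 0}"
    by simp
qed

lemma sin_add_sin_diff_sin_add:
  "sin x + sin y - sin (x + y) = 4 * sin (x / 2) * sin (y / 2) * sin ((x + y) / 2)" for x y :: real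
proof -
  define p q where "p = x / 2" and "q = y / 2"
  then have x: "x = 2 * p" and y: "y = 2 * q"
    by simp_all
  have c: "cos (2 * p) = 1 - 2 * (sin p)\<^sup>2" "cos (2 * q) = 1 - 2 * (sin q)\<^sup>2"
    by (simp_all add: cos_double_sin)
  have "sin (2 * p) + sin (2 * q) - sin (2 * p + 2 * q) = 4 * sin p * sin q * sin (p + q)"
    unfolding sin_add c sin_double by (simp add: algebra_simps power2_eq_square)
  moreover have "(2 * p + 2 * q) / 2 = p + q" "2 * p / 2 = p" "2 * q / 2 = q"
    by simp_all
  ultimately show ?thesis
    by (simp only: x y)
qed

text \<open>The circular counterpart of the Vandermonde factorization: the shift by \<open>b\<close>
  drops out and half-angle sines carry the sign.\<close>

lemma det_circle:
  fixes b :: real and k :: "real \<Rightarrow> real^3"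
  defines "k \<equiv> \<lambda>s. vector [1, sin (s - b), 1 - cos (s - b)]"
  shows "det (vector [k \<alpha>, k \<beta>, k \<gamma>] :: real^3^3)
    = 4 * sin ((\<beta> - \<alpha>) / 2) * sin ((\<gamma> - \<beta>) / 2) * sin ((\<gamma> - \<alpha>) / 2)"
proof -
  have "det (vector [k \<alpha>, k \<beta>, k \<gamma>] :: real^3^3)
      = sin ((\<beta> - b) - (\<alpha> - b)) + sin ((\<gamma> - b) - (\<beta> - b)) - sin ((\<gamma> - b) - (\<alpha> - b))"
    unfolding sin_diff[of "\<beta> - b"] sin_diff[of "\<gamma> - b"]
    by (simp add: k_def det_3 algebra_simps)
  also have "\<dots> = sin (\<beta> - \<alpha>) + sin (\<gamma> - \<beta>) - sin ((\<beta> - \<alpha>) + (\<gamma> - \<beta>))"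
    by simp
  finally show ?thesis
    by (simp only: sin_add_sin_diff_sin_add) simp
qed

lemma angle_representative:
  fixes \<alpha> \<beta> :: real
  obtains \<beta>' where "\<alpha> \<le> \<beta>'" "\<beta>' < \<alpha> + 2 * pi" "sin \<beta>' = sin \<beta>" "cos \<beta>' = cos \<beta>"
proof -
  obtain t where t: "0 \<le> t" "t < 2 * pi" "cos (\<beta> - \<alpha>) = cos t" "sin (\<beta> - \<alpha>) = sin t"
    using sincos_total_2pi[of "cos (\<beta> - \<alpha>)" "sin (\<beta> - \<alpha>)"] by auto
  have "sin (\<alpha> + t) = sin (\<alpha> + (\<beta> - \<alpha>))" "cos (\<alpha> + t) = cos (\<alpha> + (\<beta> - \<alpha>))"
    unfolding sin_add cos_add t by simp_all
  then show ?thesis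
    using t by (intro that[of "\<alpha> + t"]) simp_all
qed

text \<open>For the harder inclusion \<beta> and \<gamma> are moved by full turns into the period
  starting at \<alpha>, which changes neither the points nor the determinant.\<close>

lemma cyclic_order_circle:
  fixes b :: real and k :: "real \<Rightarrow> real^3" and f :: "real \<Rightarrow> 'a"
  defines "k \<equiv> \<lambda>s. vector [1, sin (s - b), 1 - cos (s - b)]"
  assumes f: "\<And>s. f s = F (cos s) (sin s)"
  shows "{(f \<alpha>, f \<beta>, f \<gamma>) | \<alpha> \<beta> \<gamma>. \<alpha> < \<beta> \<and> \<beta> < \<gamma> \<and> \<gamma> < \<alpha> + 2 * pi}
    = {(f \<alpha>, f \<beta>, f \<gamma>) | \<alpha> \<beta> \<gamma>. det (vector [k \<alpha>, k \<beta>, k \<gamma>] :: real^3^3) > 0}"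
    (is "?L = ?R")
proof
  show "?L \<subseteq> ?R"
  proof clarify
    fix \<alpha> \<beta> \<gamma> :: real
    assume "\<alpha> < \<beta>" "\<beta> < \<gamma>" "\<gamma> < \<alpha> + 2 * pi"
    then have "sin ((\<beta> - \<alpha>) / 2) > 0" "sin ((\<gamma> - \<beta>) / 2) > 0" "sin ((\<gamma> - \<alpha>) / 2) > 0"
      by (auto intro!: sin_gt_zero)
    then have "det (vector [k \<alpha>, k \<beta>, k \<gamma>] :: real^3^3) > 0"
      by (simp add: k_def det_circle)
    then show "\<exists>\<alpha>' \<beta>' \<gamma>'. (f \<alpha>, f \<beta>, f \<gamma>) = (f \<alpha>', f \<beta>', f \<gamma>')
        \<and> det (vector [k \<alpha>', k \<beta>', k \<gamma>'] :: real^3^3) > 0"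
      by blast
  qed
  show "?R \<subseteq> ?L"
  proof clarify
    fix \<alpha> \<beta> \<gamma>
    assume pos: "det (vector [k \<alpha>, k \<beta>, k \<gamma>] :: real^3^3) > 0"
    obtain \<beta>' where \<beta>': "\<alpha> \<le> \<beta>'" "\<beta>' < \<alpha> + 2 * pi" "sin \<beta>' = sin \<beta>" "cos \<beta>' = cos \<beta>"
      by (rule angle_representative)
    obtain \<gamma>' where \<gamma>': "\<alpha> \<le> \<gamma>'" "\<gamma>' < \<alpha> + 2 * pi" "sin \<gamma>' = sin \<gamma>" "cos \<gamma>' = cos \<gamma>"
      by (rule angle_representative)
    have "k \<beta>' = k \<beta>" "k \<gamma>' = k \<gamma>"
      by (simp_all add: k_def sin_diff cos_diff \<beta>' \<gamma>')
    then have "det (vector [k \<alpha>, k \<beta>, k \<gamma>] :: real^3^3)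
        = 4 * sin ((\<beta>' - \<alpha>) / 2) * sin ((\<gamma>' - \<beta>') / 2) * sin ((\<gamma>' - \<alpha>) / 2)"
      unfolding det_circle[of \<alpha> b \<beta>' \<gamma>', symmetric] by (simp only: k_def)
    with pos have "0 < 4 * (sin ((\<beta>' - \<alpha>) / 2) * sin ((\<gamma>' - \<beta>') / 2) * sin ((\<gamma>' - \<alpha>) / 2))"
      by (simp only: mult.assoc)
    then have pos': "sin ((\<beta>' - \<alpha>) / 2) * sin ((\<gamma>' - \<beta>') / 2) * sin ((\<gamma>' - \<alpha>) / 2) > 0"
      by linarith
    \<comment> \<open>Half-differences from \<alpha> lie between 0 and pi, so two of the three
      factors are nonnegative and the product fixes the sign of the third.\<close>
    have "sin ((\<beta>' - \<alpha>) / 2) \<ge> 0" "sin ((\<gamma>' - \<alpha>) / 2) \<ge> 0"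
      using \<beta>' \<gamma>' by (auto intro!: sin_ge_zero)
    with pos' have *: "sin ((\<beta>' - \<alpha>) / 2) > 0" "sin ((\<gamma>' - \<beta>') / 2) > 0"
      by (auto simp: zero_less_mult_iff)
    have "\<beta>' < \<gamma>'"
    proof (rule ccontr)
      assume "\<not> \<beta>' < \<gamma>'"
      then have "sin ((\<beta>' - \<gamma>') / 2) \<ge> 0"
        using \<beta>' \<gamma>' by (intro sin_ge_zero) auto
      moreover have "(\<gamma>' - \<beta>') / 2 = - ((\<beta>' - \<gamma>') / 2)"
        by (simp only: minus_divide_left minus_diff_eq)
      ultimately show False
        using *(2) by (metis sin_minus neg_0_less_iff_less not_less)
    qed
    moreover have "\<alpha> < \<beta>'"
      using *(1) \<beta>'(1) by (cases "\<alpha> = \<beta>'") auto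
    moreover have "f \<beta> = f \<beta>'" "f \<gamma> = f \<gamma>'"
      by (simp_all add: f \<beta>' \<gamma>')
    ultimately show "\<exists>\<alpha>' \<beta>' \<gamma>'. (f \<alpha>, f \<beta>, f \<gamma>) = (f \<alpha>', f \<beta>', f \<gamma>')
        \<and> \<alpha>' < \<beta>' \<and> \<beta>' < \<gamma>' \<and> \<gamma>' < \<alpha>' + 2 * pi"
      using \<gamma>'(2) by blast
  qed
qed

text \<open>\<open>D\<close> is the radius vector at parameter \<open>b\<close>, \<open>E\<close>
  the velocity and \<open>- D\<close> the acceleration there.\<close>

lemma round_eq_circle_of:
  fixes c u v :: "real^3" and r b :: real
  assumes r: "r > 0" and uv: "norm u = 1" "norm v = 1" "u \<bullet> v = 0"
    and f: "f = (\<lambda>\<theta>. c + r *\<^sub>R (cos \<theta> *\<^sub>R u + sin \<theta> *\<^sub>R v))"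
  defines "D \<equiv> r *\<^sub>R (cos b *\<^sub>R u + sin b *\<^sub>R v)" and "E \<equiv> r *\<^sub>R (cos b *\<^sub>R v - sin b *\<^sub>R u)"
  shows "(range f, {(f \<alpha>, f \<beta>, f \<gamma>) | \<alpha> \<beta> \<gamma>. \<alpha> < \<beta> \<and> \<beta> < \<gamma> \<and> \<gamma> < \<alpha> + 2 * pi})
    = circle_of (jet (f b) E (- D))"
proof (rule circle_eq_circle_of)
  \<comment> \<open>The lifted circle satisfies \<open>y''' = - y'\<close>, so it is its value at
    \<open>b\<close> plus sin times its first and 1 - cos times its second derivative there.\<close>
  define k :: "real \<Rightarrow> real^3" where "k = (\<lambda>s. vector [1, sin (s - b), 1 - cos (s - b)])"
  have uu: "u \<bullet> u = 1" "v \<bullet> v = 1" "v \<bullet> u = 0"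
    using uv by (simp_all add: norm_eq_1 inner_commute)
  have "r * (r * (cos b * cos b)) + r * (r * (sin b * sin b)) = r * r"
    by (simp only: distrib_left[symmetric] sin_cos_squared_add3 mult_1_right)
  then have DD: "D \<bullet> D = r * r" "E \<bullet> E = r * r" "D \<bullet> E = 0" "E \<bullet> D = 0"
    by (simp_all add: D_def E_def inner_add inner_diff uu uv algebra_simps)
  have fb: "f b = c + D"
    by (simp add: f D_def)
  have fs: "f s = c + cos (s - b) *\<^sub>R D + sin (s - b) *\<^sub>R E" for s
  proof -
    have "cos s = cos (b + (s - b))" "sin s = sin (b + (s - b))"
      by simp_all
    then have cs: "cos s = cos b * cos (s - b) - sin b * sin (s - b)"
      "sin s = sin b * cos (s - b) + cos b * sin (s - b)"
      by (simp_all only: cos_add sin_add)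
    show ?thesis
      unfolding f D_def E_def cs by (simp add: algebra_simps)
  qed
  have jet: "y v* jet (f b) E (- D) = lift (y$1, y$1 * ((c + D) \<bullet> (c + D)) + 2 * y$2 * (c \<bullet> E) - 2 * y$3 * (c \<bullet> D),
      y$1 *\<^sub>R (c + D) + y$2 *\<^sub>R E - y$3 *\<^sub>R D)" for y
    by (simp add: vector_matrix_mult_jet fb inner_add DD algebra_simps)
  have sq: "(c + a *\<^sub>R D + e *\<^sub>R E) \<bullet> (c + a *\<^sub>R D + e *\<^sub>R E)
      = c \<bullet> c + 2 * a * (c \<bullet> D) + 2 * e * (c \<bullet> E) + r * r * (a\<^sup>2 + e\<^sup>2)" for a e
    by (simp add: inner_add DD inner_commute power2_eq_square algebra_simps)
  show "ip10 (wedge (jet (f b) E (- D))) (wedge (jet (f b) E (- D))) \<noteq> 0"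
    using r by (simp add: ip10_wedge_jet DD)
  have cD: "(c + D) \<bullet> (c + D) = c \<bullet> c + 2 * (c \<bullet> D) + r * r"
    using sq[of 1 0] by simp
  have ff: "f s \<bullet> f s = (c + D) \<bullet> (c + D) + 2 * sin (s - b) * (c \<bullet> E) - 2 * (1 - cos (s - b)) * (c \<bullet> D)" for s
    unfolding fs sq cD by (simp add: algebra_simps)
  have "f s = (c + D) + sin (s - b) *\<^sub>R E - (1 - cos (s - b)) *\<^sub>R D" for s
    unfolding fs by (simp add: algebra_simps)
  then show "embed_E3 (f s) = k s v* jet (f b) E (- D)" for s
    unfolding embed_E3_lift ff jet by (simp add: k_def)
  show "x \<in> range f" if "embed_E3 x \<in> span (rows (jet (f b) E (- D)))" for x
  proof -
    from that obtain y where "embed_E3 x = y v* jet (f b) E (- D)"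
      by (auto simp: span_rows_3)
    then have x: "x = c + D + y$2 *\<^sub>R E - y$3 *\<^sub>R D"
      and xx: "x \<bullet> x = (c + D) \<bullet> (c + D) + 2 * y$2 * (c \<bullet> E) - 2 * y$3 * (c \<bullet> D)"
      by (auto simp: embed_E3_lift jet lift_eq_iff)
    from x have x': "x = c + (1 - y$3) *\<^sub>R D + y$2 *\<^sub>R E"
      by (simp add: algebra_simps)
    \<comment> \<open>The spatial component of the lift puts \<open>x\<close> in the plane of the
      circle; the quadratic one now forces distance \<open>r\<close> from the centre.\<close>
    have "r * r * ((1 - y$3)\<^sup>2 + (y$2)\<^sup>2) = r * r * 1"
      using xx unfolding cD x' sq by (simp add: algebra_simps)
    with r have "(1 - y$3)\<^sup>2 + (y$2)\<^sup>2 = 1"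
      by simp
    then obtain t where "1 - y$3 = cos t" "y$2 = sin t"
      by (metis sincos_total_2pi)
    then have "x = f (b + t)"
      by (simp add: x' fs)
    then show ?thesis
      by blast
  qed
  show "{(f \<alpha>, f \<beta>, f \<gamma>) | \<alpha> \<beta> \<gamma>. \<alpha> < \<beta> \<and> \<beta> < \<gamma> \<and> \<gamma> < \<alpha> + 2 * pi}
    = {(f \<alpha>, f \<beta>, f \<gamma>) | \<alpha> \<beta> \<gamma>. det (vector [k \<alpha>, k \<beta>, k \<gamma>] :: real^3^3) > 0}"
    unfolding k_def by (rule cyclic_order_circle) (simp add: f)
qed

text \<open>The common description of lines and round circles; uniqueness of the osculating circle
  rests on it alone, without a case split.\<close>

lemma parametrizes_circle_of:
  assumes "parametrizes f \<Gamma>"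
  obtains f' f'' where "\<And>s. (f has_vector_derivative f' s) (at s)"
    "\<And>s. (f' has_vector_derivative f'' s) (at s)" "\<And>s. f' s \<noteq> 0"
    "\<And>s. \<Gamma> = circle_of (jet (f s) (f' s) (f'' s))"
  using assms unfolding parametrizes_def
proof (elim disjE)
  assume "parametrizes_line f \<Gamma>"
  then obtain p u where u: "norm u = 1" and f: "f = (\<lambda>s. p + s *\<^sub>R u)"
    and \<Gamma>: "\<Gamma> = (range f, {(f \<alpha>, f \<beta>, f \<gamma>) | \<alpha> \<beta> \<gamma>.
      \<alpha> < \<beta> \<and> \<beta> < \<gamma> \<or> \<beta> < \<gamma> \<and> \<gamma> < \<alpha> \<or> \<gamma> < \<alpha> \<and> \<alpha> < \<beta>})"
    by (auto simp: parametrizes_line_def)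
  show thesis
  proof (rule that[of "\<lambda>_. u" "\<lambda>_. 0"])
    show "\<Gamma> = circle_of (jet (f s) u 0)" for s
      unfolding \<Gamma> by (rule line_eq_circle_of[OF u f])
    show "(f has_vector_derivative u) (at s)" for s
      unfolding f by (auto intro!: derivative_eq_intros)
  qed (use u in auto)
next
  assume "parametrizes_round f \<Gamma>"
  then obtain c r u v where r: "r > 0" and uv: "norm u = 1" "norm v = 1" "u \<bullet> v = 0"
    and f: "f = (\<lambda>\<theta>. c + r *\<^sub>R (cos \<theta> *\<^sub>R u + sin \<theta> *\<^sub>R v))"
    and \<Gamma>: "\<Gamma> = (range f, {(f \<alpha>, f \<beta>, f \<gamma>) | \<alpha> \<beta> \<gamma>. \<alpha> < \<beta> \<and> \<beta> < \<gamma> \<and> \<gamma> < \<alpha> + 2 * pi})"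
    by (auto simp: parametrizes_round_def)
  define f' where "f' = (\<lambda>s. r *\<^sub>R (cos s *\<^sub>R v - sin s *\<^sub>R u))"
  show thesis
  proof (rule that[of f' "\<lambda>s. - (r *\<^sub>R (cos s *\<^sub>R u + sin s *\<^sub>R v))"])
    show "\<Gamma> = circle_of (jet (f s) (f' s) (- (r *\<^sub>R (cos s *\<^sub>R u + sin s *\<^sub>R v))))" for s
      unfolding \<Gamma> f'_def by (rule round_eq_circle_of[OF r uv f])
    show "(f has_vector_derivative f' s) (at s)" for s
      unfolding f f'_def by (auto intro!: derivative_eq_intros simp: algebra_simps)
    show "(f' has_vector_derivative - (r *\<^sub>R (cos s *\<^sub>R u + sin s *\<^sub>R v))) (at s)" for s
      unfolding f'_def by (auto intro!: derivative_eq_intros simp: algebra_simps)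
    show "f' s \<noteq> 0" for s
    proof -
      have "r * (r * (cos s * cos s)) + r * (r * (sin s * sin s)) = r * r"
        by (simp only: distrib_left[symmetric] sin_cos_squared_add3 mult_1_right)
      then have "f' s \<bullet> f' s = r * r"
        using uv by (simp add: f'_def inner_diff norm_eq_1 inner_commute algebra_simps)
      with r show ?thesis
        by auto
    qed
  qed
qed

section \<open>Iterated derivatives\<close>

text \<open>A connected set with two points has no isolated point; this makes derivatives within
  \<open>I\<close> unique, endpoints included.\<close>

lemma interval_at_within_nontrivial:
  fixes I :: "real set"
  assumes "is_interval I" and "\<exists>a\<in>I. \<exists>b\<in>I. a < b" and "t \<in> I"
  shows "at t within I \<noteq> bot"
proof -
  have "I \<noteq> {t}"
    using assms(2) by auto
  then have "t islimpt I"
    using assms by (intro connected_imp_perfect) (auto simp: is_interval_connected_1)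
  then show ?thesis
    by (simp add: trivial_limit_within)
qed

lemma nderiv_0: "nderiv I 0 f = f"
  by (simp add: nderiv_def)

lemma nderiv_Suc: "nderiv I (Suc k) f = (\<lambda>t. vector_derivative (nderiv I k f) (at t within I))"
  by (simp add: nderiv_def)

lemma smooth_on_has_vector_derivative:
  assumes "smooth_on I f" and "t \<in> I"
  shows "(nderiv I k f has_vector_derivative nderiv I (Suc k) f t) (at t within I)"
  using assms by (simp add: smooth_on_def nderiv_Suc vector_derivative_works)

text \<open>An explicit chain \<open>F\<close> of successive derivatives identifies
  \<open>nderiv\<close>. They agree on \<open>I\<close> only, so each step transfers the derivative
  within \<open>I\<close>.\<close>

lemma has_vector_derivative_nderiv:
  assumes "\<And>t. t \<in> I \<Longrightarrow> at t within I \<noteq> bot"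
    and F: "\<And>k t. k < n \<Longrightarrow> t \<in> I \<Longrightarrow> (F k has_vector_derivative F (Suc k) t) (at t within I)"
    and "k \<le> n" "t \<in> I"
  shows "nderiv I k (F 0) t = F k t"
  using assms(3,4)
proof (induction k arbitrary: t)
  case (Suc k)
  then have "(F k has_vector_derivative F (Suc k) t) (at t within I)"
    by (intro F) auto
  then have "(nderiv I k (F 0) has_vector_derivative F (Suc k) t) (at t within I)"
    using Suc by (auto intro: has_vector_derivative_transform[rotated 2])
  then show ?case
    unfolding nderiv_Suc by (rule vector_derivative_within[OF assms(1)[OF Suc.prems(2)]])
qed (simp add: nderiv_0)

lemma smooth_onI:
  assumes "\<And>t. t \<in> I \<Longrightarrow> at t within I \<noteq> bot"
    and F: "\<And>k t. t \<in> I \<Longrightarrow> (F k has_vector_derivative F (Suc k) t) (at t within I)"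
  shows "smooth_on I (F 0)"
  unfolding smooth_on_def
proof (intro allI ballI)
  fix k t assume t: "t \<in> I"
  have "nderiv I k (F 0) s = F k s" if "s \<in> I" for s
    using assms that by (intro has_vector_derivative_nderiv[where n = k]) auto
  then have "(nderiv I k (F 0) has_vector_derivative F (Suc k) t) (at t within I)"
    using F[OF t] t by (auto intro: has_vector_derivative_transform[rotated 2])
  then show "nderiv I k (F 0) differentiable at t within I"
    by (rule differentiableI_vector)
qed

lemma nderiv_compose:
  fixes \<phi> :: "real \<Rightarrow> real"
  assumes nontriv: "\<And>t. t \<in> I \<Longrightarrow> at t within I \<noteq> bot" and \<phi>: "smooth_on I \<phi>"
    and g: "\<And>s. (g has_vector_derivative g' s) (at s)"
    and g': "\<And>s. (g' has_vector_derivative g'' s) (at s)" and t: "t \<in> I"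
  shows "nderiv I 1 (g \<circ> \<phi>) t = nderiv I 1 \<phi> t *\<^sub>R g' (\<phi> t)"
    and "nderiv I 2 (g \<circ> \<phi>) t = (nderiv I 1 \<phi> t)\<^sup>2 *\<^sub>R g'' (\<phi> t) + nderiv I 2 \<phi> t *\<^sub>R g' (\<phi> t)"
proof -
  \<comment> \<open>Entries beyond index 2 are filler: only \<open>F 0\<close> and
    \<open>F 1\<close> get differentiated.\<close>
  define F where
    "F k = (if k = 0 then g \<circ> \<phi> else if k = 1 then (\<lambda>s. nderiv I 1 \<phi> s *\<^sub>R g' (\<phi> s))
      else (\<lambda>s. (nderiv I 1 \<phi> s)\<^sup>2 *\<^sub>R g'' (\<phi> s) + nderiv I 2 \<phi> s *\<^sub>R g' (\<phi> s)))" for k :: nat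
  have \<phi>': "(\<phi> has_vector_derivative nderiv I 1 \<phi> s) (at s within I)"
    and \<phi>'': "(nderiv I 1 \<phi> has_vector_derivative nderiv I 2 \<phi> s) (at s within I)" if "s \<in> I" for s
    using smooth_on_has_vector_derivative[OF \<phi> that, of 0]
      smooth_on_has_vector_derivative[OF \<phi> that, of 1]
    by (simp_all add: nderiv_0 numeral_2_eq_2)
  have chain: "((h \<circ> \<phi>) has_vector_derivative nderiv I 1 \<phi> s *\<^sub>R h') (at s within I)"
    if "s \<in> I" "(h has_vector_derivative h') (at (\<phi> s))" for h h' s
    using vector_diff_chain_within[OF \<phi>'[OF that(1)], of h h'] that(2)
    by (simp add: has_vector_derivative_at_within)
  have "(F k has_vector_derivative F (Suc k) s) (at s within I)" if "k < 2" "s \<in> I" for k s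
  proof -
    have "((\<lambda>s. nderiv I 1 \<phi> s *\<^sub>R g' (\<phi> s)) has_vector_derivative
        nderiv I 1 \<phi> s *\<^sub>R (nderiv I 1 \<phi> s *\<^sub>R g'' (\<phi> s)) + nderiv I 2 \<phi> s *\<^sub>R g' (\<phi> s)) (at s within I)"
      using \<phi>''[OF that(2)] chain[OF that(2) g']
      by (intro has_vector_derivative_scaleR)
        (simp_all add: has_real_derivative_iff_has_vector_derivative o_def)
    moreover have "k = 0 \<or> k = 1"
      using that by auto
    ultimately show ?thesis
      using chain[OF that(2) g] by (auto simp: F_def power2_eq_square)
  qed
  then have "nderiv I k (F 0) t = F k t" if "k \<le> 2" for k
    using that t nontriv by (intro has_vector_derivative_nderiv[where n = 2]) auto
  from this[of 1] this[of 2] show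
    "nderiv I 1 (g \<circ> \<phi>) t = nderiv I 1 \<phi> t *\<^sub>R g' (\<phi> t)"
    "nderiv I 2 (g \<circ> \<phi>) t = (nderiv I 1 \<phi> t)\<^sup>2 *\<^sub>R g'' (\<phi> t) + nderiv I 2 \<phi> t *\<^sub>R g' (\<phi> t)"
    by (simp_all add: F_def)
qed

text \<open>A change of parameter affects a 2-jet only through its own derivatives \<open>p\<close>
  and \<open>q\<close> at \<open>t\<close>, and every pair with \<open>p > 0\<close> occurs.\<close>

lemma oriented_contact2_iff:
  assumes nontriv: "\<And>t. t \<in> I \<Longrightarrow> at t within I \<noteq> bot" and t: "t \<in> I"
    and g: "\<And>s. (g has_vector_derivative g' s) (at s)"
    and g': "\<And>s. (g' has_vector_derivative g'' s) (at s)"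
  shows "oriented_contact2 I C t g b \<longleftrightarrow>
    (\<exists>p q. p > 0 \<and> C t = g b \<and> nderiv I 1 C t = p *\<^sub>R g' b
      \<and> nderiv I 2 C t = p\<^sup>2 *\<^sub>R g'' b + q *\<^sub>R g' b)"
proof
  assume "oriented_contact2 I C t g b"
  then obtain \<phi> where \<phi>: "smooth_on I \<phi>" "\<phi> t = b" "nderiv I 1 \<phi> t > 0"
    and eq: "\<forall>k\<le>2. nderiv I k (g \<circ> \<phi>) t = nderiv I k C t"
    by (auto simp: oriented_contact2_def)
  have "C t = g b" "nderiv I 1 C t = nderiv I 1 (g \<circ> \<phi>) t" "nderiv I 2 C t = nderiv I 2 (g \<circ> \<phi>) t"
    using eq[rule_format, of 0] eq[rule_format, of 1] eq[rule_format, of 2] \<phi>(2)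
    by (simp_all add: nderiv_0)
  with \<phi> show "\<exists>p q. p > 0 \<and> C t = g b \<and> nderiv I 1 C t = p *\<^sub>R g' b
      \<and> nderiv I 2 C t = p\<^sup>2 *\<^sub>R g'' b + q *\<^sub>R g' b"
    using nderiv_compose[OF nontriv \<phi>(1) g g' t] by metis
next
  assume "\<exists>p q. p > 0 \<and> C t = g b \<and> nderiv I 1 C t = p *\<^sub>R g' b
      \<and> nderiv I 2 C t = p\<^sup>2 *\<^sub>R g'' b + q *\<^sub>R g' b"
  then obtain p q where pq: "p > 0" "C t = g b" "nderiv I 1 C t = p *\<^sub>R g' b"
    "nderiv I 2 C t = p\<^sup>2 *\<^sub>R g'' b + q *\<^sub>R g' b"
    by blast
  \<comment> \<open>A quadratic polynomial with value \<open>b\<close>, slope \<open>p\<close> and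
    second derivative \<open>q\<close> at \<open>t\<close>. A positive slope is demanded at
    \<open>t\<close> alone, so it may decrease elsewhere.\<close>
  define F :: "nat \<Rightarrow> real \<Rightarrow> real" where
    "F k = (if k = 0 then (\<lambda>s. b + p * (s - t) + q / 2 * (s - t)\<^sup>2) else if k = 1 then (\<lambda>s. p + q * (s - t))
      else if k = 2 then (\<lambda>s. q) else (\<lambda>s. 0))" for k
  have F: "(F k has_vector_derivative F (Suc k) s) (at s within I)" for k s
    unfolding F_def has_real_derivative_iff_has_vector_derivative[symmetric]
    by (auto intro!: derivative_eq_intros simp: field_simps)
  have smooth: "smooth_on I (F 0)"
    using nontriv F by (rule smooth_onI)
  have "nderiv I k (F 0) t = F k t" if "k \<le> 2" for k
    using nontriv F that t by (rule has_vector_derivative_nderiv)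
  from this[of 1] this[of 2] have F12: "nderiv I 1 (F 0) t = p" "nderiv I 2 (F 0) t = q"
    by (simp_all add: F_def)
  have F0: "F 0 t = b"
    by (simp add: F_def)
  have "nderiv I k (g \<circ> F 0) t = nderiv I k C t" if "k \<le> 2" for k
  proof -
    have "k = 0 \<or> k = 1 \<or> k = 2"
      using that by auto
    moreover have "nderiv I 1 (g \<circ> F 0) t = nderiv I 1 (F 0) t *\<^sub>R g' (F 0 t)"
      by (rule nderiv_compose(1)[OF nontriv smooth g g' t])
    then have "nderiv I 1 (g \<circ> F 0) t = nderiv I 1 C t"
      by (simp only: F12 F0 pq)
    moreover have "nderiv I 2 (g \<circ> F 0) t
        = (nderiv I 1 (F 0) t)\<^sup>2 *\<^sub>R g'' (F 0 t) + nderiv I 2 (F 0) t *\<^sub>R g' (F 0 t)"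
      by (rule nderiv_compose(2)[OF nontriv smooth g g' t])
    then have "nderiv I 2 (g \<circ> F 0) t = nderiv I 2 C t"
      by (simp only: F12 F0 pq)
    ultimately show ?thesis
      by (auto simp: nderiv_0 F0 pq)
  qed
  with smooth F0 F12 pq(1) show "oriented_contact2 I C t g b"
    unfolding oriented_contact2_def by (intro exI[of _ "F 0"]) simp
qed

section \<open>Osculating circles\<close>

text \<open>Uniqueness: contact changes the jet only within its orientation class, which determines
  \<open>circle_of\<close>.\<close>

lemma osculates_imp_circle_of:
  assumes nontriv: "\<And>t. t \<in> I \<Longrightarrow> at t within I \<noteq> bot" and t: "t \<in> I" and "osculates I C t \<Gamma>"
  shows "\<Gamma> = circle_of (jet (C t) (nderiv I 1 C t) (nderiv I 2 C t))"
proof -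
  from assms(3) obtain g b where g: "parametrizes g \<Gamma>" and contact: "oriented_contact2 I C t g b"
    by (auto simp: osculates_def)
  from g obtain g' g'' where g': "\<And>s. (g has_vector_derivative g' s) (at s)"
    and g'': "\<And>s. (g' has_vector_derivative g'' s) (at s)"
    and \<Gamma>: "\<And>s. \<Gamma> = circle_of (jet (g s) (g' s) (g'' s))"
    by (rule parametrizes_circle_of) blast
  from contact obtain p q where "p > 0" "C t = g b" "nderiv I 1 C t = p *\<^sub>R g' b"
    "nderiv I 2 C t = p\<^sup>2 *\<^sub>R g'' b + q *\<^sub>R g' b"
    using oriented_contact2_iff[where g' = g' and g'' = g'', OF nontriv t g' g''] by blast
  then show ?thesis
    using \<Gamma>[of b] by (simp add: circle_of_orientation_class[OF jet_reparametrize])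
qed

lemma osculating_circle_exists:
  assumes nontriv: "\<And>t. t \<in> I \<Longrightarrow> at t within I \<noteq> bot" and t: "t \<in> I"
    and C: "nderiv I 1 C t \<noteq> 0"
  shows "\<exists>\<Gamma>\<in>S13. osculates I C t \<Gamma>"
proof -
  define x v a where "x = C t" and "v = nderiv I 1 C t" and "a = nderiv I 2 C t"
  define e where "e = v /\<^sub>R norm v"
  have v: "norm v > 0" and e: "norm e = 1"
    using C by (simp_all add: v_def e_def)
  have ve: "v = norm v *\<^sub>R e"
    using v by (simp add: e_def)
  \<comment> \<open>The normal component of the acceleration; its vanishing decides between a line
    and a round circle.\<close>
  define d where "d = a - (a \<bullet> e) *\<^sub>R e"
  have ed: "d \<bullet> e = 0"
    using e by (simp add: d_def inner_diff_left norm_eq_1)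
  show ?thesis
  proof (cases "d = 0")
    case True
    define g where "g = (\<lambda>s. x + s *\<^sub>R e)"
    have "oriented_contact2 I C t g 0"
    proof (subst oriented_contact2_iff[OF nontriv t])
      show "(g has_vector_derivative e) (at s)" for s
        unfolding g_def by (auto intro!: derivative_eq_intros)
      show "((\<lambda>_. e) has_vector_derivative 0) (at s)" for s :: real
        by simp
      have "a = (norm v)\<^sup>2 *\<^sub>R 0 + (a \<bullet> e) *\<^sub>R e"
        using True by (simp add: d_def)
      moreover have "x = g 0"
        by (simp add: g_def)
      ultimately show "\<exists>p q. 0 < p \<and> C t = g 0 \<and> nderiv I 1 C t = p *\<^sub>R e
          \<and> nderiv I 2 C t = p\<^sup>2 *\<^sub>R 0 + q *\<^sub>R e"
        unfolding x_def[symmetric] v_def[symmetric] a_def[symmetric]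
        using v ve by blast
    qed
    moreover have "parametrizes g (range g, {(g \<alpha>, g \<beta>, g \<gamma>) | \<alpha> \<beta> \<gamma>.
        \<alpha> < \<beta> \<and> \<beta> < \<gamma> \<or> \<beta> < \<gamma> \<and> \<gamma> < \<alpha> \<or> \<gamma> < \<alpha> \<and> \<alpha> < \<beta>})"
      unfolding parametrizes_def parametrizes_line_def using e g_def by blast
    ultimately show ?thesis
      unfolding osculates_def S13_def by blast
  next
    case False
    \<comment> \<open>The curvature is \<open>norm d / (norm v)\<^sup>2\<close>, and
      \<open>r\<close> is its inverse; \<open>u\<close> points from the centre to the curve point,
      opposite to \<open>d\<close>.\<close>
    define r u where "r = (norm v)\<^sup>2 / norm d" and "u = - (d /\<^sub>R norm d)"
    have r: "r > 0" and u: "norm u = 1" "u \<bullet> e = 0"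
      using False v ed by (simp_all add: r_def u_def)
    define g where "g = (\<lambda>\<theta>. (x - r *\<^sub>R u) + r *\<^sub>R (cos \<theta> *\<^sub>R u + sin \<theta> *\<^sub>R e))"
    define g' where "g' = (\<lambda>\<theta>. r *\<^sub>R (cos \<theta> *\<^sub>R e - sin \<theta> *\<^sub>R u))"
    have "oriented_contact2 I C t g 0"
    proof (subst oriented_contact2_iff[OF nontriv t])
      show "(g has_vector_derivative g' s) (at s)" for s
        unfolding g_def g'_def by (auto intro!: derivative_eq_intros simp: algebra_simps)
      show "(g' has_vector_derivative - (r *\<^sub>R (cos s *\<^sub>R u + sin s *\<^sub>R e))) (at s)" for s
        unfolding g'_def by (auto intro!: derivative_eq_intros simp: algebra_simps)
      \<comment> \<open>\<open>g\<close> has speed \<open>r\<close>, so contact needs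
        \<open>p = norm v / r\<close> and, for the tangential acceleration,
        \<open>q = (a \<bullet> e) / r\<close>.\<close>
      have "v = (norm v / r) *\<^sub>R g' 0"
        using ve r by (simp add: g'_def)
      moreover have "a = (norm v / r)\<^sup>2 *\<^sub>R (- (r *\<^sub>R (cos 0 *\<^sub>R u + sin 0 *\<^sub>R e))) + ((a \<bullet> e) / r) *\<^sub>R g' 0"
      proof -
        have "(norm v / r)\<^sup>2 * r = (norm v)\<^sup>2 / r"
          using r by (simp add: power2_eq_square field_simps)
        also have "\<dots> = norm d"
          using v False by (simp add: r_def)
        finally have "((norm v / r)\<^sup>2 * r / norm d) *\<^sub>R d = d"
          using False by simp
        then have "(norm v / r)\<^sup>2 *\<^sub>R (- (r *\<^sub>R u)) = d"
          by (simp add: u_def divide_inverse mult.assoc)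
        then show ?thesis
          using r by (simp add: g'_def d_def)
      qed
      moreover have "x = g 0" "norm v / r > 0"
        using v r by (simp_all add: g_def)
      ultimately show "\<exists>p q. 0 < p \<and> C t = g 0 \<and> nderiv I 1 C t = p *\<^sub>R g' 0
          \<and> nderiv I 2 C t = p\<^sup>2 *\<^sub>R (- (r *\<^sub>R (cos 0 *\<^sub>R u + sin 0 *\<^sub>R e))) + q *\<^sub>R g' 0"
        unfolding x_def[symmetric] v_def[symmetric] a_def[symmetric] by blast
    qed
    moreover have "parametrizes g (range g, {(g \<alpha>, g \<beta>, g \<gamma>) | \<alpha> \<beta> \<gamma>. \<alpha> < \<beta> \<and> \<beta> < \<gamma> \<and> \<gamma> < \<alpha> + 2 * pi})"
      unfolding parametrizes_def parametrizes_round_def using r u e g_def by blast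
    ultimately show ?thesis
      unfolding osculates_def S13_def by blast
  qed
qed

text \<open>Supplies the witness for \<open>circle_point_circle_of\<close>. The parameters 0, 1, 2
  serve lines and circles alike, since 2 is less than a full turn.\<close>

lemma S13_triple:
  assumes "\<Gamma> \<in> S13"
  obtains p q r where "(p, q, r) \<in> snd \<Gamma>"
proof -
  from assms obtain f where "parametrizes f \<Gamma>"
    by (auto simp: S13_def)
  have order: "(0::real) < 1" "(1::real) < 2" "2 < 0 + 2 * pi"
    using pi_gt3 by simp_all
  have "(f 0, f 1, f 2) \<in> snd \<Gamma>" if "parametrizes_round f \<Gamma>"
  proof -
    from that have "snd \<Gamma> = {(f \<alpha>, f \<beta>, f \<gamma>) | \<alpha> \<beta> \<gamma>. \<alpha> < \<beta> \<and> \<beta> < \<gamma> \<and> \<gamma> < \<alpha> + 2 * pi}"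
      unfolding parametrizes_round_def by (elim conjE) (simp only: snd_conv)
    with order show ?thesis
      by blast
  qed
  moreover have "(f 0, f 1, f 2) \<in> snd \<Gamma>" if "parametrizes_line f \<Gamma>"
  proof -
    from that have "snd \<Gamma> = {(f \<alpha>, f \<beta>, f \<gamma>) | \<alpha> \<beta> \<gamma>.
        \<alpha> < \<beta> \<and> \<beta> < \<gamma> \<or> \<beta> < \<gamma> \<and> \<gamma> < \<alpha> \<or> \<gamma> < \<alpha> \<and> \<alpha> < \<beta>}"
      unfolding parametrizes_line_def by (elim conjE) (simp only: snd_conv)
    with order show ?thesis
      by blast
  qed
  ultimately have "(f 0, f 1, f 2) \<in> snd \<Gamma>"
    using \<open>parametrizes f \<Gamma>\<close> by (auto simp: parametrizes_def)
  then show thesis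
    by (rule that)
qed

text \<open>Both definite descriptions are resolved here; afterwards only calculus and Gram
  determinants remain.\<close>

lemma circle_point_osculating_circle:
  assumes nontriv: "\<And>t. t \<in> I \<Longrightarrow> at t within I \<noteq> bot" and t: "t \<in> I"
    and C: "nderiv I 1 C t \<noteq> 0"
  shows "circle_point (osculating_circle I C t)
    = wedge (jet (C t) (nderiv I 1 C t) (nderiv I 2 C t)) /\<^sub>R norm (nderiv I 1 C t) ^ 3"
proof -
  define J where "J = jet (C t) (nderiv I 1 C t) (nderiv I 2 C t)"
  obtain \<Gamma> where \<Gamma>: "\<Gamma> \<in> S13" "osculates I C t \<Gamma>"
    using osculating_circle_exists[OF assms] by blast
  have unique: "\<Gamma>' = circle_of J" if "osculates I C t \<Gamma>'" for \<Gamma>'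
    unfolding J_def using nontriv t that by (rule osculates_imp_circle_of)
  have "osculating_circle I C t = circle_of J"
    unfolding osculating_circle_def
  proof (rule the_equality)
    show "circle_of J \<in> S13 \<and> osculates I C t (circle_of J)"
      using \<Gamma> unique[OF \<Gamma>(2)] by simp
    show "\<Gamma>' = circle_of J" if "\<Gamma>' \<in> S13 \<and> osculates I C t \<Gamma>'" for \<Gamma>'
      using that unique by blast
  qed
  moreover from \<Gamma> unique obtain p q r where "(p, q, r) \<in> snd (circle_of J)"
    by (metis S13_triple)
  moreover have "ip10 (wedge J) (wedge J) \<noteq> 0"
    using C by (simp add: J_def ip10_wedge_jet)
  ultimately show ?thesis
    by (simp add: circle_point_circle_of J_def norm10_wedge_jet)
qed

section \<open>Differentiating the curve of osculating circles\<close>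

lemma has_vector_derivative_vec_iff:
  "(f has_vector_derivative f') (at t within S)
    \<longleftrightarrow> (\<forall>i. ((\<lambda>s. f s $ i) has_real_derivative f' $ i) (at t within S))"
  for f :: "real \<Rightarrow> real^'n"
proof -
  have "(f has_vector_derivative f') (at t within S)
      \<longleftrightarrow> (\<forall>i. ((\<lambda>s. f s \<bullet> axis i 1) has_derivative (\<lambda>h. (h *\<^sub>R f') \<bullet> axis i 1)) (at t within S))"
    unfolding has_vector_derivative_def has_derivative_componentwise_within[of f]
    by (auto simp: Basis_vec_def)
  then show ?thesis
    by (simp add: inner_axis has_field_derivative_def mult_commute_abs)
qed

text \<open>Reduces differentiation of ten coordinates to that of one generic minor.\<close>

lemma wedge_component: "\<exists>a b c. \<forall>X. wedge X $ i = minor3 X a b c"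
proof -
  have "UNIV = {1, 2, 3, 4, 5, 6, 7, 8, 9, 10 :: 10}"
    by (rule card_seteq[symmetric]) simp_all
  then have "i \<in> {1, 2, 3, 4, 5, 6, 7, 8, 9, 10}"
    by blast
  then show ?thesis
    unfolding wedge_def by (elim insertE emptyE) (simp_all only: vector_10, blast+)
qed

text \<open>The derivative of a determinant is a sum over its rows; for the rows
  \<open>x, x', x''\<close> all but the last summand have a repeated row.\<close>

lemma has_vector_derivative_wedge:
  assumes x: "(x has_vector_derivative y t) (at t within S)"
    and y: "(y has_vector_derivative z t) (at t within S)"
    and z: "(z has_vector_derivative w) (at t within S)"
  shows "((\<lambda>s. wedge (vector [x s, y s, z s])) has_vector_derivative
    wedge (vector [x t, y t, w])) (at t within S)"
  unfolding has_vector_derivative_vec_iff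
proof
  fix i
  obtain a b c where abc: "wedge X $ i = minor3 X a b c" for X
    using wedge_component by blast
  note [derivative_intros] = x[unfolded has_vector_derivative_vec_iff, rule_format]
    y[unfolded has_vector_derivative_vec_iff, rule_format]
    z[unfolded has_vector_derivative_vec_iff, rule_format]
  show "((\<lambda>s. wedge (vector [x s, y s, z s]) $ i) has_real_derivative
      wedge (vector [x t, y t, w]) $ i) (at t within S)"
    unfolding abc minor3_def det_3 column_def
    by (auto intro!: derivative_eq_intros simp: algebra_simps)
qed

text \<open>The factor 3 comes from differentiating \<open>v \<bullet> v + x \<bullet> a\<close>:
  the first term gives \<open>v \<bullet> a\<close> twice, the second once.\<close>

lemma has_vector_derivative_wedge_jet:
  assumes x: "(x has_vector_derivative v t) (at t within S)"
    and v: "(v has_vector_derivative a t) (at t within S)"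
    and a: "(a has_vector_derivative j) (at t within S)"
  shows "((\<lambda>s. wedge (jet (x s) (v s) (a s))) has_vector_derivative
    wedge (vector [lift (1, x t \<bullet> x t, x t), lift (0, 2 * (x t \<bullet> v t), v t),
      lift (0, 2 * (3 * (v t \<bullet> a t) + x t \<bullet> j), j)])) (at t within S)"
  unfolding jet_def
proof (rule has_vector_derivative_wedge)
  have inner: "((\<lambda>s. f s \<bullet> g s) has_vector_derivative f t \<bullet> g' + f' \<bullet> g t) (at t within S)"
    if "(f has_vector_derivative f') (at t within S)" "(g has_vector_derivative g') (at t within S)"
    for f g :: "real \<Rightarrow> real^3" and f' g'
    using bounded_bilinear.has_vector_derivative[OF bounded_bilinear_inner that] .
  note lift_deriv = bounded_linear.has_vector_derivative[OF bounded_linear_lift]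
  show "((\<lambda>s. lift (1, x s \<bullet> x s, x s)) has_vector_derivative
      lift (0, 2 * (x t \<bullet> v t), v t)) (at t within S)"
    by (rule lift_deriv) (auto intro!: derivative_eq_intros inner x simp: inner_commute)
  show "((\<lambda>s. lift (0, 2 * (x s \<bullet> v s), v s)) has_vector_derivative
      lift (0, 2 * (v t \<bullet> v t + x t \<bullet> a t), a t)) (at t within S)"
    by (rule lift_deriv) (auto intro!: derivative_eq_intros inner x v simp: inner_commute)
  show "((\<lambda>s. lift (0, 2 * (v s \<bullet> v s + x s \<bullet> a s), a s)) has_vector_derivative
      lift (0, 2 * (3 * (v t \<bullet> a t) + x t \<bullet> j), j)) (at t within S)"
    by (rule lift_deriv) (auto intro!: derivative_eq_intros inner x v a simp: inner_commute)
qed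

lemma has_real_derivative_inverse_norm_power3:
  fixes v :: "real \<Rightarrow> 'a::real_inner"
  assumes v: "(v has_vector_derivative a) (at t within S)" and "v t \<noteq> 0"
  shows "((\<lambda>s. inverse (norm (v s) ^ 3)) has_real_derivative - 3 * (v t \<bullet> a) / norm (v t) ^ 5) (at t within S)"
proof -
  have "((\<lambda>s. v s \<bullet> v s) has_real_derivative 2 * (v t \<bullet> a)) (at t within S)"
    using bounded_bilinear.has_vector_derivative[OF bounded_bilinear_inner v v]
    by (simp add: has_real_derivative_iff_has_vector_derivative inner_commute)
  then have "((\<lambda>s. sqrt (v s \<bullet> v s)) has_real_derivative
      inverse (sqrt (v t \<bullet> v t)) / 2 * (2 * (v t \<bullet> a))) (at t within S)"
    using assms(2) by (intro DERIV_chain2[OF DERIV_real_sqrt]) auto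
  then have "((\<lambda>s. norm (v s)) has_real_derivative (v t \<bullet> a) / norm (v t)) (at t within S)"
    by (simp add: norm_eq_sqrt_inner[symmetric] field_simps)
  then show ?thesis
    using assms(2) by (auto intro!: derivative_eq_intros simp: field_simps eval_nat_numeral)
qed

text \<open>With \<open>m = v \<bullet> a\<close> and \<open>W = x \<and> x' \<and> x''\<close>, \<open>W' = x \<and> x' \<and> x'''\<close> for the lifted curve, the
  Gram determinants are \<open>\<langle>W, W\<rangle> = \<bar>v\<bar>\<^sup>6\<close>, \<open>\<langle>W, W'\<rangle> = 3 m \<bar>v\<bar>\<^sup>4\<close> and \<open>\<langle>W', W'\<rangle> = 9 m\<^sup>2 \<bar>v\<bar>\<^sup>2\<close>, so the
  quadratic form in the derivative is a perfect square.\<close>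

lemma ip10_derivative_normalized_jet:
  fixes x v a j :: "real^3"
  assumes "v \<noteq> 0"
  defines "W \<equiv> wedge (jet x v a)"
    and "W' \<equiv> wedge (vector [lift (1, x \<bullet> x, x), lift (0, 2 * (x \<bullet> v), v),
      lift (0, 2 * (3 * (v \<bullet> a) + x \<bullet> j), j)])"
  shows "ip10 (inverse (norm v ^ 3) *\<^sub>R W' + (- 3 * (v \<bullet> a) / norm v ^ 5) *\<^sub>R W)
    (inverse (norm v ^ 3) *\<^sub>R W' + (- 3 * (v \<bullet> a) / norm v ^ 5) *\<^sub>R W) = 0"
proof -
  have v: "v \<bullet> v = (norm v)\<^sup>2"
    by (simp add: power2_norm_eq_inner)
  have WW: "ip10 W W = norm v ^ 6"
    by (simp add: W_def ip10_wedge_jet v power_mult[symmetric])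
  have "ip10 W W' = 3 * (v \<bullet> a) * (v \<bullet> v)\<^sup>2" "ip10 W' W' = 9 * (v \<bullet> a)\<^sup>2 * (v \<bullet> v)"
    by (simp_all add: W_def W'_def jet_def ip10_wedge det_3 mink_lift inner_commute
        power2_eq_square field_simps)
  then have WW': "ip10 W W' = 3 * (v \<bullet> a) * norm v ^ 4" "ip10 W' W' = 9 * (v \<bullet> a)\<^sup>2 * (norm v)\<^sup>2"
    by (simp_all add: v power_mult[symmetric])
  have "ip10 (p *\<^sub>R W' + q *\<^sub>R W) (p *\<^sub>R W' + q *\<^sub>R W)
      = p\<^sup>2 * ip10 W' W' + 2 * p * q * ip10 W W' + q\<^sup>2 * ip10 W W" for p q
    by (simp add: ip10_def power2_eq_square algebra_simps)
  note expand = this[of "inverse (norm v ^ 3)" "- 3 * (v \<bullet> a) / norm v ^ 5"]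
  show ?thesis
    unfolding expand WW WW' using assms(1) by (simp add: field_simps eval_nat_numeral)
qed

theorem theorem7p2:
  fixes C :: "real \<Rightarrow> real^3" and I :: "real set" and \<gamma> :: "real \<Rightarrow> real^10"
  assumes "is_interval I" and "\<exists>a\<in>I. \<exists>b\<in>I. a < b"
    and "smooth_on I C" and "regular_on I C"
    and "\<And>t. t \<in> I \<Longrightarrow> \<gamma> t = circle_point (osculating_circle I C t)"
  shows "lightlike_on ip10 I \<gamma>"
  unfolding lightlike_on_def
proof
  fix t assume t: "t \<in> I"
  have nontriv: "at s within I \<noteq> bot" if "s \<in> I" for s
    using assms(1,2) that by (rule interval_at_within_nontrivial)
  define v a j where "v = nderiv I 1 C" and "a = nderiv I 2 C" and "j = nderiv I 3 C"
  have C: "(C has_vector_derivative v t) (at t within I)"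
    and v: "(v has_vector_derivative a t) (at t within I)"
    and a: "(a has_vector_derivative j t) (at t within I)"
    using smooth_on_has_vector_derivative[OF assms(3) t, of 0]
      smooth_on_has_vector_derivative[OF assms(3) t, of 1]
      smooth_on_has_vector_derivative[OF assms(3) t, of 2]
    by (simp_all add: v_def a_def j_def nderiv_0 numeral_2_eq_2 numeral_3_eq_3)
  have v0: "v s \<noteq> 0" if "s \<in> I" for s
    using assms(4) that by (simp add: regular_on_def v_def)
  define W where "W = (\<lambda>s. wedge (jet (C s) (v s) (a s)))"
  have \<gamma>: "\<gamma> s = inverse (norm (v s) ^ 3) *\<^sub>R W s" if "s \<in> I" for s
    using assms(5)[OF that] circle_point_osculating_circle[OF nontriv that] v0[OF that]
    by (simp add: W_def v_def a_def)
  define \<gamma>' where "\<gamma>' = inverse (norm (v t) ^ 3) *\<^sub>R wedge (vector [lift (1, C t \<bullet> C t, C t),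
      lift (0, 2 * (C t \<bullet> v t), v t), lift (0, 2 * (3 * (v t \<bullet> a t) + C t \<bullet> j t), j t)])
    + (- 3 * (v t \<bullet> a t) / norm (v t) ^ 5) *\<^sub>R W t"
  have "((\<lambda>s. inverse (norm (v s) ^ 3) *\<^sub>R W s) has_vector_derivative \<gamma>') (at t within I)"
    unfolding \<gamma>'_def W_def
    by (intro has_vector_derivative_scaleR has_real_derivative_inverse_norm_power3
        has_vector_derivative_wedge_jet C v a v0 t)
  \<comment> \<open>\<gamma> is prescribed on \<open>I\<close> only, so the derivative is
    transferred within \<open>I\<close>.\<close>
  then have \<gamma>_deriv: "(\<gamma> has_vector_derivative \<gamma>') (at t within I)"
    using \<gamma> t by (auto intro: has_vector_derivative_transform[rotated 2])
  then have "nderiv I 1 \<gamma> t = \<gamma>'"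
    using vector_derivative_within[OF nontriv[OF t]] by (simp add: nderiv_def)
  \<comment> \<open>With \<open>m = v \<bullet> a\<close>, the form on \<open>p W' + q W\<close> is
    the square of \<open>3 p m |v| + q |v|^3\<close>. The product rule gives
    \<open>p = |v|^-3\<close> and \<open>q = -3 m |v|^-5\<close>, for which this vanishes.\<close>
  moreover have "ip10 \<gamma>' \<gamma>' = 0"
    unfolding \<gamma>'_def W_def using v0[OF t] by (rule ip10_derivative_normalized_jet)
  ultimately show "\<gamma> differentiable at t within I \<and> ip10 (nderiv I 1 \<gamma> t) (nderiv I 1 \<gamma> t) = 0"
    using \<gamma>_deriv by (auto intro: differentiableI_vector)
qed

end
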